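(* Suppose that Assumptions (I), (II) and (III) listed in the context hold. Then: (a) There exists a solution $(g^*,\tilde u)\in\mathbb R\times B_W(\mathbb N_0\times\mathbb N_0)$ to the average-cost optimality equation (ACOE) $$g^*=\inf_{a\in[\gamma,R]}\Big\{r(n,i,a)+\sum_{(m,j)}\tilde u(m,j)\,\pi^{a}_{(n,i)(m,j)}\Big\}\qquad\text{for all }(n,i)\in\mathbb N_0\times\mathbb N_0 .$$ Moreover, the constant $g^*$ coincides with the optimal average cost function, i.e. $g^*=J^*(n,i)$ for all $(n,i)\in\mathbb N_0\times\mathbb N_0$, and $\tilde u$ is unique up to additive constants. (b) A stationary policy $\beta^*\in\mathscr U_{SM}$ is average-cost optimal if and only if it attains the minimum in the ACOE, i.e. $$g^*=r(n,i,\beta^*(n,i))+\sum_{(m,j)}\tilde u(m,j)\,\pi^{\beta^*}_{(n,i)(m,j)}\qquad\text{for all }(n,i)\in\mathbb N_0\times\mathbb N_0 .$$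
   Context: Notation: $\mathbb N_0=\{0,1,2,\dots\}$; $\delta_{(n,i)(m,j)}$ is the Kronecker delta on $\mathbb N_0\times\mathbb N_0$; sums over $(m,j)$ run over $\mathbb N_0\times\mathbb N_0$. Control model: $\lambda,\mu>0$ and $0<\gamma\le R<\infty$ are constants. The state space is $\mathbb N_0\times\mathbb N_0$ (state $(n,i)$: $n$ customers, $i$ items in inventory), the action space in every state is $[\gamma,R]$ (production rates). For $a\in[\gamma,R]$ the transition rates are: $\pi^{a}_{(n,i)(n,i+1)}=a$ for all $n,i\ge0$; $\pi^{a}_{(n,i)(n+1,i)}=\lambda$ for $n\ge0,i\ge1$; $\pi^{a}_{(n,i)(n-1,i-1)}=\mu$ for $n,i\ge1$; all other off-diagonal rates are $0$; and $\pi^{a}_{(n,i)(n,i)}=-\sum_{(m,j)\ne(n,i)}\pi^a_{(n,i)(m,j)}$. Put $\pi^*_{(n,i)}:=\sup_{a\in[\gamma,R]}\big(-\pi^{a}_{(n,i)(n,i)}\big)$. The cost rate is $r(n,i,a)=c_0\, i+c_1 n+a\,c_2\,\mathbf 1_{\{i>S\}}+c_3\,n\,\mathbf 1_{\{i=0\}}$ with constants $c_0,c_1,c_2,c_3\ge0$ and $S\in\mathbb N_0$. Policies: $\mathscr U_{SM}$ is the set of all functions $\beta:\mathbb N_0\times\mathbb N_0\to[\gamma,R]$ (deterministic stationary policies). For $\beta\in\mathscr U_{SM}$, write $\pi^\beta_{(n,i)(m,j)}=\pi^{\beta(n,i)}_{(n,i)(m,j)}$, let $Y(t)$ be the right-continuous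 Markov chain with these rates, and let $P^\beta_{(n,i)},E^\beta_{(n,i)}$ be the probability and expectation when $Y(0)=(n,i)$. Criterion: $J(n,i,\beta)=\limsup_{T\to\infty}\frac1T E^\beta_{(n,i)}\int_0^T r(Y(t),\beta(Y(t-)))\,dt$ and $J^*(n,i)=\inf_{\beta\in\mathscr U_{SM}}J(n,i,\beta)$; $\beta^*$ is average-cost optimal if $J(n,i,\beta^* )=J^*(n,i)$ for all $(n,i)$. Weighted space: for $V\ge1$, $\|u\|_V=\sup_{(n,i)}|u(n,i)|/V(n,i)$ and $B_V(\mathbb N_0\times\mathbb N_0)=\{u:\mathbb N_0\times\mathbb N_0\to\mathbb R:\|u\|_V<\infty\}$. Assumption (I): there are a function $W\ge1$ on $\mathbb N_0\times\mathbb N_0$, nondecreasing along some fixed enumeration of $\mathbb N_0\times\mathbb N_0$, and constants $\bar c_1>0$, $\bar b_1\ge0$, $M>0$ such that for all $(n,i)$ and $a\in[\gamma,R]$: $\sum_{(m,j)}\pi^{a}_{(n,i)(m,j)}W(m,j)\le-\bar c_1W(n,i)+\bar b_1\delta_{(n,i)(0,0)}$ and $r(n,i,a)\le M\,W(n,i)$. Under (I), for each $\beta\in\mathscr U_{SM}$ the (irreducible) chain $Y$ has a unique invariant probability measure $\vartheta_\beta$, and $\vartheta_\beta(u):=\sum_{(m,j)}u(m,j)\vartheta_\beta(m,j)$ is finite for $u\in B_W(\mathbb N_0\times\mathbb N_0)$. Assumption (II): with $W$ as in (I), there are a nonnegative function $W'$ on $\mathbb N_0\times\mathbb N_0$ and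 constants $c'>0$, $b'\ge0$, $M'>0$ such that for all $(n,i)$ and $a\in[\gamma,R]$: $\pi^*_{(n,i)}W(n,i)\le M'W'(n,i)$ and $\sum_{(m,j)}\pi^{a}_{(n,i)(m,j)}W'(m,j)\le c'W'(n,i)+b'$. Assumption (III) (uniform ergodicity): with $W$ as in (I), there are constants $\delta>0$, $L_2>0$ such that $\sup_{\beta\in\mathscr U_{SM}}|E^\beta_{(n,i)}u(Y(t))-\vartheta_\beta(u)|\le L_2e^{-\delta t}\|u\|_W W(n,i)$ for all $(n,i)$, all $u\in B_W(\mathbb N_0\times\mathbb N_0)$ and all $t\ge0$. *)

theory Defs
  imports "HOL-Probability.Probability"
begin

text \<open>A state \<open>(n, i)\<close> is a pair of the number of customers and the inventory level.\<close>

type_synonym state = "nat \<times> nat"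
type_synonym policy = "state \<Rightarrow> real"

fun jump_rate :: "real \<Rightarrow> real \<Rightarrow> real \<Rightarrow> state \<Rightarrow> state \<Rightarrow> real" where
  "jump_rate lam mu a (n, i) (m, j) =
    (if m = n \<and> j = i + 1 then a
     else if m = n + 1 \<and> j = i \<and> i \<ge> 1 then lam
     else if n = m + 1 \<and> i = j + 1 then mu
     else 0)"

definition rate :: "real \<Rightarrow> real \<Rightarrow> real \<Rightarrow> state \<Rightarrow> state \<Rightarrow> real" where
  "rate lam mu a x y =
    (if y = x then - (\<Sum>\<^sub>\<infinity>z\<in>UNIV - {x}. jump_rate lam mu a x z)
     else jump_rate lam mu a x y)"

fun cost_rate :: "real \<Rightarrow> real \<Rightarrow> real \<Rightarrow> real \<Rightarrow> nat \<Rightarrow> state \<Rightarrow> real \<Rightarrow> real" where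
  "cost_rate c0 c1 c2 c3 S (n, i) a =
    c0 * real i + c1 * real n + a * c2 * of_bool (i > S) + c3 * real n * of_bool (i = 0)"

text \<open>In what follows \<open>A\<close> is the action space, \<open>q a x y\<close> the rate from \<open>x\<close> to \<open>y\<close> under
  action \<open>a\<close>, and \<open>r x a\<close> the cost rate.\<close>

definition max_exit_rate :: "(real \<Rightarrow> state \<Rightarrow> state \<Rightarrow> real) \<Rightarrow> real set \<Rightarrow> state \<Rightarrow> real" where
  "max_exit_rate q A x = (SUP a\<in>A. - q a x x)"

definition stationary_policies :: "real set \<Rightarrow> policy set" where
  "stationary_policies A = {\<beta>. \<forall>x. \<beta> x \<in> A}"

definition policy_rate :: "(real \<Rightarrow> state \<Rightarrow> state \<Rightarrow> real) \<Rightarrow> policy \<Rightarrow> state \<Rightarrow> state \<Rightarrow> real" where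
  "policy_rate q \<beta> x y = q (\<beta> x) x y"

text \<open>Taking the rows of the transition function to be probability mass functions makes it
  honest (no mass escapes to infinity). The rates of the model are bounded, so the derivative at
  \<open>0\<close> determines the transition function.\<close>

definition transition_function :: "(real \<Rightarrow> 's \<Rightarrow> 's pmf) \<Rightarrow> bool" where
  "transition_function P \<longleftrightarrow>
    (\<forall>x. P 0 x = return_pmf x) \<and>
    (\<forall>s\<ge>0. \<forall>t\<ge>0. \<forall>x. P (s + t) x = bind_pmf (P s x) (P t))"

definition has_rates :: "(real \<Rightarrow> 's \<Rightarrow> 's pmf) \<Rightarrow> ('s \<Rightarrow> 's \<Rightarrow> real) \<Rightarrow> bool" where
  "has_rates P Q \<longleftrightarrow>
    (\<forall>x y. ((\<lambda>t. pmf (P t x) y) has_real_derivative Q x y) (at_right 0))"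

text \<open>The Markov property is stated through finite-dimensional distributions, in product form
  so as not to condition on null events.\<close>

definition markov_with :: "'w measure \<Rightarrow> (real \<Rightarrow> 'w \<Rightarrow> 's) \<Rightarrow> (real \<Rightarrow> 's \<Rightarrow> 's pmf) \<Rightarrow> bool" where
  "markov_with M Y P \<longleftrightarrow>
    (\<forall>(k::nat) (t :: nat \<Rightarrow> real) (x :: nat \<Rightarrow> 's). 0 \<le> t 0 \<longrightarrow> (\<forall>l<k. t l < t (Suc l)) \<longrightarrow>
      measure M {\<omega> \<in> space M. \<forall>l\<le>k. Y (t l) \<omega> = x l} =
      measure M {\<omega> \<in> space M. Y (t 0) \<omega> = x 0} *
        (\<Prod>l<k. pmf (P (t (Suc l) - t l) (x l)) (x (Suc l))))"

text \<open>The topology of \<^typ>\<open>state\<close> is the discrete one, so the two path conditions say that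
  every path is locally constant to the right and eventually constant from the left. Left limits
  are required because the average cost below refers to \<open>Y(t-)\<close>.\<close>

definition markov_chain ::
  "'w measure \<Rightarrow> (real \<Rightarrow> 'w \<Rightarrow> state) \<Rightarrow> (state \<Rightarrow> state \<Rightarrow> real) \<Rightarrow> state \<Rightarrow> bool" where
  "markov_chain M Y Q x \<longleftrightarrow>
    prob_space M \<and>
    (\<forall>t\<ge>0. Y t \<in> measurable M (count_space UNIV)) \<and>
    (\<forall>\<omega>\<in>space M. \<forall>t\<ge>0. ((\<lambda>s. Y s \<omega>) \<longlongrightarrow> Y t \<omega>) (at_right t)) \<and>
    (\<forall>\<omega>\<in>space M. \<forall>t>0. \<exists>y. ((\<lambda>s. Y s \<omega>) \<longlongrightarrow> y) (at_left t)) \<and>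
    (AE \<omega> in M. Y 0 \<omega> = x) \<and>
    (\<exists>P. transition_function P \<and> has_rates P Q \<and> markov_with M Y P)"

text \<open>Below, \<open>Y \<beta>\<close> is the controlled process under the policy \<open>\<beta>\<close> and \<open>Pr \<beta> x\<close> the probability
  measure under which it starts in \<open>x\<close>. Average costs are extended reals, and since the cost rate
  is nonnegative the expected cumulative cost is a nonnegative integral; thus no integrability is
  presupposed.\<close>

definition average_cost ::
  "(state \<Rightarrow> real \<Rightarrow> real) \<Rightarrow> (policy \<Rightarrow> state \<Rightarrow> 'w measure) \<Rightarrow> (policy \<Rightarrow> real \<Rightarrow> 'w \<Rightarrow> state) \<Rightarrow>
    state \<Rightarrow> policy \<Rightarrow> ereal" where
  "average_cost r Pr Y x \<beta> =
    Limsup at_top (\<lambda>T::real. ereal (1 / T) * enn2ereal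
      (\<integral>\<^sup>+\<omega>. (\<integral>\<^sup>+t\<in>{0..T}.
          ennreal (r (Y \<beta> t \<omega>) (\<beta> (Lim (at_left t) (\<lambda>s. Y \<beta> s \<omega>)))) \<partial>lborel) \<partial>Pr \<beta> x))"

definition optimal_average_cost ::
  "real set \<Rightarrow> (state \<Rightarrow> real \<Rightarrow> real) \<Rightarrow> (policy \<Rightarrow> state \<Rightarrow> 'w measure) \<Rightarrow>
    (policy \<Rightarrow> real \<Rightarrow> 'w \<Rightarrow> state) \<Rightarrow> state \<Rightarrow> ereal" where
  "optimal_average_cost A r Pr Y x = (INF \<beta>\<in>stationary_policies A. average_cost r Pr Y x \<beta>)"

definition average_cost_optimal ::
  "real set \<Rightarrow> (state \<Rightarrow> real \<Rightarrow> real) \<Rightarrow> (policy \<Rightarrow> state \<Rightarrow> 'w measure) \<Rightarrow>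
    (policy \<Rightarrow> real \<Rightarrow> 'w \<Rightarrow> state) \<Rightarrow> policy \<Rightarrow> bool" where
  "average_cost_optimal A r Pr Y \<beta> \<longleftrightarrow>
    (\<forall>x. average_cost r Pr Y x \<beta> = optimal_average_cost A r Pr Y x)"

definition weighted_norm :: "(state \<Rightarrow> real) \<Rightarrow> (state \<Rightarrow> real) \<Rightarrow> real" where
  "weighted_norm V u = (SUP x. \<bar>u x\<bar> / V x)"

definition weighted_space :: "(state \<Rightarrow> real) \<Rightarrow> (state \<Rightarrow> real) set" where
  "weighted_space V = {u. bdd_above (range (\<lambda>x. \<bar>u x\<bar> / V x))}"

definition invariant_pmf ::
  "(state \<Rightarrow> 'w measure) \<Rightarrow> (real \<Rightarrow> 'w \<Rightarrow> state) \<Rightarrow> state pmf \<Rightarrow> bool" where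
  "invariant_pmf M Y \<theta> \<longleftrightarrow>
    (\<forall>t\<ge>0. \<forall>y. (\<Sum>\<^sub>\<infinity>x. pmf \<theta> x * measure (M x) {\<omega> \<in> space (M x). Y t \<omega> = y}) = pmf \<theta> y)"

text \<open>The chain is irreducible and, under the first assumption below, positive recurrent, so
  the description is proper wherever it is used.\<close>

definition the_invariant_pmf ::
  "(state \<Rightarrow> 'w measure) \<Rightarrow> (real \<Rightarrow> 'w \<Rightarrow> state) \<Rightarrow> state pmf" where
  "the_invariant_pmf M Y = (THE \<theta>. invariant_pmf M Y \<theta>)"

definition pmf_mean :: "state pmf \<Rightarrow> (state \<Rightarrow> real) \<Rightarrow> real" where
  "pmf_mean \<theta> u = (\<Sum>\<^sub>\<infinity>y. u y * pmf \<theta> y)"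

definition assumption_I ::
  "real set \<Rightarrow> (real \<Rightarrow> state \<Rightarrow> state \<Rightarrow> real) \<Rightarrow> (state \<Rightarrow> real \<Rightarrow> real) \<Rightarrow> (state \<Rightarrow> real) \<Rightarrow> bool" where
  "assumption_I A q r W \<longleftrightarrow>
    (\<forall>x. W x \<ge> 1) \<and>
    (\<exists>e :: nat \<Rightarrow> state. bij e \<and> mono (\<lambda>k. W (e k))) \<and>
    (\<exists>c b M. c > 0 \<and> b \<ge> 0 \<and> M > 0 \<and>
      (\<forall>x. \<forall>a\<in>A. (\<Sum>\<^sub>\<infinity>y. q a x y * W y) \<le> - c * W x + b * of_bool (x = (0, 0))
        \<and> r x a \<le> M * W x))"

definition assumption_II ::
  "real set \<Rightarrow> (real \<Rightarrow> state \<Rightarrow> state \<Rightarrow> real) \<Rightarrow> (state \<Rightarrow> real) \<Rightarrow> bool" where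
  "assumption_II A q W \<longleftrightarrow>
    (\<exists>(W' :: state \<Rightarrow> real) c' b' M'. (\<forall>x. W' x \<ge> 0) \<and> c' > 0 \<and> b' \<ge> 0 \<and> M' > 0 \<and>
      (\<forall>x. \<forall>a\<in>A. max_exit_rate q A x * W x \<le> M' * W' x
        \<and> (\<Sum>\<^sub>\<infinity>y. q a x y * W' y) \<le> c' * W' x + b'))"

definition assumption_III ::
  "real set \<Rightarrow> (policy \<Rightarrow> state \<Rightarrow> 'w measure) \<Rightarrow> (policy \<Rightarrow> real \<Rightarrow> 'w \<Rightarrow> state) \<Rightarrow>
    (state \<Rightarrow> real) \<Rightarrow> bool" where
  "assumption_III A Pr Y W \<longleftrightarrow>
    (\<exists>\<delta> L. \<delta> > 0 \<and> L > 0 \<and>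
      (\<forall>x. \<forall>u\<in>weighted_space W. \<forall>t\<ge>0. \<forall>\<beta>\<in>stationary_policies A.
        \<bar>(\<integral>\<omega>. u (Y \<beta> t \<omega>) \<partial>Pr \<beta> x) - pmf_mean (the_invariant_pmf (Pr \<beta>) (Y \<beta>)) u\<bar>
          \<le> L * exp (- \<delta> * t) * weighted_norm W u * W x))"

definition solves_ACOE ::
  "real set \<Rightarrow> (real \<Rightarrow> state \<Rightarrow> state \<Rightarrow> real) \<Rightarrow> (state \<Rightarrow> real \<Rightarrow> real) \<Rightarrow> real \<Rightarrow>
    (state \<Rightarrow> real) \<Rightarrow> bool" where
  "solves_ACOE A q r g u \<longleftrightarrow>
    (\<forall>x. g = (INF a\<in>A. r x a + (\<Sum>\<^sub>\<infinity>y. u y * q a x y)))"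

definition attains_ACOE ::
  "(real \<Rightarrow> state \<Rightarrow> state \<Rightarrow> real) \<Rightarrow> (state \<Rightarrow> real \<Rightarrow> real) \<Rightarrow> real \<Rightarrow>
    (state \<Rightarrow> real) \<Rightarrow> policy \<Rightarrow> bool" where
  "attains_ACOE q r g u \<beta> \<longleftrightarrow>
    (\<forall>x. g = r x (\<beta> x) + (\<Sum>\<^sub>\<infinity>y. u y * policy_rate q \<beta> x y))"

end

theory Submission imports Defs begin

text \<open>
  Why the theorem holds. The optimality equation is solved without probability. All rates are bounded by
  \<open>\<Lambda> = R + \<lambda> + \<mu>\<close>, so the generator can be uniformized, and by the drift condition
  the chain killed on entering \<open>(0, 0)\<close> contracts in a weighted supremum norm. Hence for every real \<open>g\<close> the
  problem of paying \<open>r - g\<close> until the chain enters \<open>(0, 0)\<close> has a value function \<open>U g\<close> (lemma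
  \<open>ex_fixpoint\<close>), and a \<open>g\<close> with \<open>U g (0, 0) = 0\<close>, which the intermediate value theorem supplies,
  gives a solution (\<open>acoe_solvable\<close>). The same contraction yields a maximum principle for the killed chain
  (\<open>killed_maximum_principle\<close>), and with it the uniqueness of the solution for given \<open>g\<close>
  up to constants (\<open>acoe_unique\<close>). Rates and costs are affine in the action, so all minima are attained at
  \<open>\<gamma>\<close> or \<open>R\<close>.

  The probabilistic half rests on Dynkin's formula, written with the occupation measure \<open>O\<close> of the chain up to
  time \<open>T\<close>, which has mass \<open>T\<close>: \<open>E f(Y(T)) - f(x)\<close> is the \<open>O\<close>-integral of the generator applied to
  \<open>f\<close>. It is proved for bounded \<open>f\<close> from the derivative of the transition function at \<open>0\<close>
  (\<open>Dynkin_bounded\<close>), and extends to functions dominated by \<open>W\<close> by truncation and dominated convergence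
  (\<open>Dynkin_weighted\<close>). For a solution \<open>(g, u)\<close> and a policy \<open>\<beta>\<close> let
  \<open>d = r + G u - g\<close>, which is nonnegative, denote the amount by which \<open>\<beta>\<close> misses the minimum. Then the
  expected cost up to \<open>T\<close> is \<open>g T\<close> plus the \<open>O\<close>-integral of \<open>d\<close> plus a bounded
  term (\<open>cumulative_cost_decomposition\<close>). So the average cost is at least \<open>g\<close>, with equality if
  \<open>d = 0\<close>. Conversely, the drift condition forces \<open>O\<close> to charge \<open>(0, 0)\<close>, and by irreducibility
  every state, with a mass that grows linearly in \<open>T\<close> (\<open>occupation_grows\<close>), so \<open>d > 0\<close> anywhere
  makes the average cost exceed \<open>g\<close>.
\<close>

section \<open>Expectations of bounded functions\<close>

lemma pmf_integrable_bounded: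
  fixes f :: "'s \<Rightarrow> real"
  assumes "\<And>x. \<bar>f x\<bar> \<le> C"
  shows "integrable (measure_pmf p) f"
  by (rule measure_pmf.integrable_const_bound[where B = C]) (use assms in auto)

lemma abs_pmf_expectation_le:
  fixes f :: "'s \<Rightarrow> real"
  assumes "\<And>x. \<bar>f x\<bar> \<le> C"
  shows "\<bar>measure_pmf.expectation p f\<bar> \<le> C"
proof -
  have i: "integrable (measure_pmf p) f" using assms by (rule pmf_integrable_bounded)
  have "measure_pmf.expectation p f \<le> C"
    by (rule measure_pmf.integral_le_const[OF i]) (use assms in \<open>auto simp: abs_le_iff\<close>)
  moreover have "- C \<le> measure_pmf.expectation p f"
    by (rule measure_pmf.integral_ge_const[OF i])
      (use assms in \<open>auto simp: abs_le_iff intro!: AE_pmfI simp: minus_le_iff\<close>)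
  ultimately show ?thesis by (simp add: abs_le_iff minus_le_iff)
qed

lemma expectation_bind_pmf_bounded:
  fixes f :: "'s \<Rightarrow> real"
  assumes f: "\<And>x. \<bar>f x\<bar> \<le> C"
  shows "measure_pmf.expectation (bind_pmf p k) f =
    measure_pmf.expectation p (\<lambda>x. measure_pmf.expectation (k x) f)"
proof -
  have i: "integrable (measure_pmf q) f" for q using f by (rule pmf_integrable_bounded)
  have i2: "integrable (measure_pmf p) (\<lambda>x. measure_pmf.expectation (k x) f)"
    by (rule pmf_integrable_bounded[where C = C]) (rule abs_pmf_expectation_le[OF f])
  \<comment> \<open>Adding \<open>C\<close> makes \<open>f\<close> nonnegative, so that the formula for nonnegative integrals applies.\<close>
  have C: "0 \<le> f x + C" for x using f[of x] by linarith
  have nn: "ennreal (measure_pmf.expectation q f + C) = (\<integral>\<^sup>+x. ennreal (f x + C) \<partial>measure_pmf q)" for q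
  proof -
    have "(\<integral>\<^sup>+x. ennreal (f x + C) \<partial>measure_pmf q) = ennreal (measure_pmf.expectation q (\<lambda>x. f x + C))"
      by (rule nn_integral_eq_integral) (use i C in auto)
    then show ?thesis using i by simp
  qed
  have C2: "0 \<le> measure_pmf.expectation q f + C" for q
    using abs_pmf_expectation_le[of f C q] f by fastforce
  have "ennreal (measure_pmf.expectation (bind_pmf p k) f + C) =
      (\<integral>\<^sup>+x. ennreal (measure_pmf.expectation (k x) f + C) \<partial>measure_pmf p)"
    unfolding nn by (simp add: nn)
  also have "\<dots> = ennreal (measure_pmf.expectation p (\<lambda>x. measure_pmf.expectation (k x) f + C))"
    by (rule nn_integral_eq_integral) (use i2 C2 in auto)
  also have "\<dots> = ennreal (measure_pmf.expectation p (\<lambda>x. measure_pmf.expectation (k x) f) + C)"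
    using i2 by simp
  finally have "measure_pmf.expectation (bind_pmf p k) f + C =
      measure_pmf.expectation p (\<lambda>x. measure_pmf.expectation (k x) f) + C"
    using C2 abs_pmf_expectation_le[of "\<lambda>x. measure_pmf.expectation (k x) f" C p, OF abs_pmf_expectation_le[OF f]]
    by (subst (asm) ennreal_inj) auto
  then show ?thesis by simp
qed

section \<open>Transition functions with bounded rates\<close>

text \<open>A Markov transition function on a countable set whose rates at \<open>0\<close> are given by a
  conservative matrix \<open>Q\<close> with finitely supported rows (the row of \<open>x\<close> lives on \<open>N x\<close>) and with exit
  rates at most \<open>\<Lambda>\<close>.\<close>

locale bounded_rate_semigroup =
  fixes P :: "real \<Rightarrow> 's::countable \<Rightarrow> 's pmf" and Q :: "'s \<Rightarrow> 's \<Rightarrow> real"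
    and N :: "'s \<Rightarrow> 's set" and \<Lambda> :: real
  assumes transition: "transition_function P"
    and rates: "has_rates P Q"
    and finite_N: "finite (N x)"
    and Q_outside: "y \<notin> N x \<Longrightarrow> Q x y = 0"
    and Q_conservative: "(\<Sum>y\<in>N x. Q x y) = 0"
    and self_in_N: "x \<in> N x"
    and exit_rate_le: "- Q x x \<le> \<Lambda>"
begin

text \<open>\<open>E t f x\<close> is the expectation of \<open>f\<close> at time \<open>t\<close> when the chain starts in \<open>x\<close>.\<close>

definition E :: "real \<Rightarrow> ('s \<Rightarrow> real) \<Rightarrow> 's \<Rightarrow> real" where
  "E t f x = measure_pmf.expectation (P t x) f"

text \<open>The generator.\<close>

definition L :: "('s \<Rightarrow> real) \<Rightarrow> 's \<Rightarrow> real" where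
  "L f x = (\<Sum>y\<in>N x. Q x y * f y)"

lemma P_0: "P 0 x = return_pmf x"
  using transition by (simp add: transition_function_def)

lemma P_add: "s \<ge> 0 \<Longrightarrow> t \<ge> 0 \<Longrightarrow> P (s + t) x = bind_pmf (P s x) (P t)"
  using transition by (simp add: transition_function_def)

lemma E_0: "E 0 f x = f x"
  by (simp add: E_def P_0)

lemma E_add:
  assumes "s \<ge> 0" "t \<ge> 0" "\<And>y. \<bar>f y\<bar> \<le> C"
  shows "E (s + t) f x = E s (E t f) x"
  using expectation_bind_pmf_bounded[of f C "P s x" "P t", OF assms(3)] assms(1,2)
  by (simp add: E_def[abs_def] P_add)

lemma abs_E_le: "(\<And>y. \<bar>f y\<bar> \<le> C) \<Longrightarrow> \<bar>E t f x\<bar> \<le> C"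
  unfolding E_def by (rule abs_pmf_expectation_le)

lemma E_diff:
  assumes "\<And>y. \<bar>f y\<bar> \<le> C" "\<And>y. \<bar>g y\<bar> \<le> D"
  shows "E t (\<lambda>y. f y - g y) x = E t f x - E t g x"
  unfolding E_def
  by (rule Bochner_Integration.integral_diff)
    (rule pmf_integrable_bounded[OF assms(1)], rule pmf_integrable_bounded[OF assms(2)])

lemma pmf_rate: "((\<lambda>t. (pmf (P t x) y - (if y = x then 1 else 0)) / t) \<longlongrightarrow> Q x y) (at_right 0)"
  using rates unfolding has_rates_def has_field_derivative_iff
  by (auto simp: P_0 pmf_return indicator_def of_bool_def eq_commute[of y x])

text \<open>Supermultiplicativity of the holding probability and the Bernoulli inequality turn the
  pointwise derivative at \<open>0\<close> into a bound that is uniform in the state.\<close>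

lemma leaving_probability_le:
  assumes t: "t \<ge> 0"
  shows "1 - pmf (P t x) x \<le> \<Lambda> * t"
proof (cases "t = 0")
  case False
  then have t0: "t > 0" using t by simp
  define \<phi> where "\<phi> s = pmf (P s x) x" for s
  have mult: "\<phi> s * \<phi> u \<le> \<phi> (s + u)" if "s \<ge> 0" "u \<ge> 0" for s u
  proof -
    have "\<phi> (s + u) = measure_pmf.expectation (P s x) (\<lambda>z. pmf (P u z) x)"
      unfolding \<phi>_def P_add[OF that] by (rule pmf_bind)
    also have "\<dots> \<ge> measure_pmf.expectation (P s x) (\<lambda>z. \<phi> u * indicator {x} z)"
      by (rule integral_mono)
        (auto simp: \<phi>_def indicator_def pmf_le_1
          intro!: pmf_integrable_bounded[where C = 1])
    finally show ?thesis by (simp add: \<phi>_def measure_pmf_single mult.commute)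
  qed
  have pow: "\<phi> s ^ n \<le> \<phi> (real n * s)" if "s \<ge> 0" for s n
  proof (induction n)
    case 0
    then show ?case by (simp add: \<phi>_def P_0)
  next
    case (Suc n)
    have "\<phi> s ^ Suc n \<le> \<phi> s * \<phi> (real n * s)"
      using Suc by (simp add: mult_left_mono \<phi>_def)
    also have "\<dots> \<le> \<phi> (s + real n * s)" using that by (intro mult) auto
    finally show ?case by (simp add: algebra_simps)
  qed
  have bern: "1 + t * ((\<phi> (t / real (Suc n)) - 1) / (t / real (Suc n))) \<le> \<phi> t" for n
  proof -
    have "1 + real (Suc n) * (\<phi> (t / real (Suc n)) - 1) \<le> (1 + (\<phi> (t / real (Suc n)) - 1)) ^ Suc n"
      by (rule Bernoulli_inequality) (simp add: \<phi>_def)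
    also have "\<dots> \<le> \<phi> t" using pow[of "t / real (Suc n)" "Suc n"] t0 by simp
    finally show ?thesis using t0 by (simp del: of_nat_Suc add: mult.commute)
  qed
  have "(\<lambda>n. t / real (Suc n)) \<longlonglongrightarrow> 0"
    by (rule LIMSEQ_Suc) (rule lim_const_over_n)
  then have "filterlim (\<lambda>n. t / real (Suc n)) (at_right 0) sequentially"
    using t0 by (auto simp: filterlim_at intro!: always_eventually)
  from filterlim_compose[OF pmf_rate[of x x] this]
  have "(\<lambda>n. (\<phi> (t / real (Suc n)) - 1) / (t / real (Suc n))) \<longlonglongrightarrow> Q x x"
    by (simp add: \<phi>_def)
  then have "(\<lambda>n. 1 + t * ((\<phi> (t / real (Suc n)) - 1) / (t / real (Suc n)))) \<longlonglongrightarrow> 1 + t * Q x x"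
    by (intro tendsto_intros)
  then have "1 + t * Q x x \<le> \<phi> t"
    by (rule LIMSEQ_le_const2) (use bern in blast)
  moreover have "t * (- Q x x) \<le> t * \<Lambda>"
    using exit_rate_le[of x] t by (rule mult_left_mono)
  ultimately show ?thesis by (simp add: \<phi>_def algebra_simps)
qed (simp add: P_0)

lemma bound_nonneg: "(\<And>y::'s. \<bar>f y\<bar> \<le> C) \<Longrightarrow> 0 \<le> (C::real)"
  using abs_ge_zero order_trans by blast

lemma \<Lambda>_nonneg: "0 \<le> \<Lambda>"
  using leaving_probability_le[of 1] pmf_le_1[of "P 1 undefined" undefined] by (metis diff_ge_0_iff_ge mult.right_neutral order_trans zero_le_one)

lemma E_increment_le:
  assumes f: "\<And>y. \<bar>f y\<bar> \<le> C" and t: "t \<ge> 0"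
  shows "\<bar>E t f x - f x\<bar> \<le> 2 * C * \<Lambda> * t"
proof -
  have "E t f x - f x = E t (\<lambda>y. f y - f x) x"
    by (subst E_diff[OF f f[of x]]) (simp add: E_def)
  also have "\<bar>\<dots>\<bar> \<le> measure_pmf.expectation (P t x) (\<lambda>y. \<bar>f y - f x\<bar>)"
    unfolding E_def by (rule integral_abs_bound)
  also have "\<dots> \<le> measure_pmf.expectation (P t x) (\<lambda>y. 2 * C * (1 - indicator {x} y))"
  proof (rule integral_mono)
    have b: "\<bar>f y - f x\<bar> \<le> 2 * C" for y using f[of y] f[of x] by linarith
    then show "\<bar>f y - f x\<bar> \<le> 2 * C * (1 - indicator {x} y)" for y
      by (auto simp: indicator_def)
    show "integrable (measure_pmf (P t x)) (\<lambda>y. \<bar>f y - f x\<bar>)"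
      by (rule pmf_integrable_bounded[where C = "2 * C"]) (use b in auto)
    show "integrable (measure_pmf (P t x)) (\<lambda>y. 2 * C * (1 - indicator {x} y))"
      by (rule pmf_integrable_bounded[where C = "2 * C"])
        (use bound_nonneg[OF f] in \<open>auto simp: indicator_def\<close>)
  qed
  also have "\<dots> = 2 * C * (1 - pmf (P t x) x)"
    by (subst integral_mult_right_zero, subst Bochner_Integration.integral_diff)
      (auto simp: measure_pmf_single intro!: pmf_integrable_bounded[where C = 1])
  also have "\<dots> \<le> 2 * C * (\<Lambda> * t)"
    using leaving_probability_le[OF t] bound_nonneg[OF f] by (intro mult_left_mono) auto
  finally show ?thesis by (simp add: mult.assoc)
qed

lemma mass_outside_N: "((\<lambda>t. (1 - measure (P t x) (N x)) / t) \<longlongrightarrow> 0) (at_right 0)"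
proof -
  have "((\<lambda>t. - (\<Sum>y\<in>N x. (pmf (P t x) y - (if y = x then 1 else 0)) / t)) \<longlongrightarrow>
      - (\<Sum>y\<in>N x. Q x y)) (at_right 0)"
    by (intro tendsto_minus tendsto_sum pmf_rate)
  moreover have "- (\<Sum>y\<in>N x. (pmf (P t x) y - (if y = x then 1 else 0)) / t) =
      (1 - measure (P t x) (N x)) / t" for t
    using finite_N self_in_N
    by (simp add: measure_measure_pmf_finite sum_subtractf diff_divide_distrib flip: sum_divide_distrib)
  ultimately show ?thesis by (simp add: Q_conservative)
qed

lemma E_generator:
  assumes f: "\<And>y. \<bar>f y\<bar> \<le> C"
  shows "((\<lambda>t. (E t f x - f x) / t) \<longlongrightarrow> L f x) (at_right 0)"
proof -
  define A where "A t = (\<Sum>y\<in>N x. (pmf (P t x) y - (if y = x then 1 else 0)) / t * f y)" for t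
  have A: "(A \<longlongrightarrow> L f x) (at_right 0)"
    unfolding A_def L_def by (intro tendsto_intros pmf_rate)
  have if1: "integrable (measure_pmf p) (\<lambda>y. f y * indicator X y)" for p X
    by (rule pmf_integrable_bounded[where C = C])
      (use f bound_nonneg[OF f] in \<open>auto simp: indicator_def abs_mult\<close>)
  have eq: "E t f x - f x - t * A t =
      measure_pmf.expectation (P t x) (\<lambda>y. f y * indicator (- N x) y)" if t: "t > 0" for t
  proof -
    have "E t f x = measure_pmf.expectation (P t x)
        (\<lambda>y. f y * indicator (N x) y + f y * indicator (- N x) y)"
      unfolding E_def by (rule Bochner_Integration.integral_cong) (auto simp: indicator_def)
    also have "\<dots> = measure_pmf.expectation (P t x) (\<lambda>y. f y * indicator (N x) y) +
        measure_pmf.expectation (P t x) (\<lambda>y. f y * indicator (- N x) y)"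
      by (rule Bochner_Integration.integral_add) (rule if1)+
    also have "measure_pmf.expectation (P t x) (\<lambda>y. f y * indicator (N x) y) =
        (\<Sum>y\<in>N x. pmf (P t x) y * f y)"
      by (subst integral_measure_pmf_real[OF finite_N[of x]])
        (auto simp: indicator_def mult.commute intro!: sum.cong)
    finally have *: "E t f x = (\<Sum>y\<in>N x. pmf (P t x) y * f y) +
        measure_pmf.expectation (P t x) (\<lambda>y. f y * indicator (- N x) y)" .
    have "t * A t = (\<Sum>y\<in>N x. pmf (P t x) y * f y - (if y = x then f y else 0))"
      unfolding A_def sum_distrib_left by (rule sum.cong) (use t in \<open>auto simp: field_simps\<close>)
    also have "\<dots> = (\<Sum>y\<in>N x. pmf (P t x) y * f y) - f x"
      using finite_N self_in_N by (simp add: sum_subtractf)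
    finally show ?thesis using * by simp
  qed
  have bound: "\<bar>(E t f x - f x) / t - A t\<bar> \<le> C * ((1 - measure (P t x) (N x)) / t)" if t: "t > 0" for t
  proof -
    have "\<bar>E t f x - f x - t * A t\<bar> \<le>
        measure_pmf.expectation (P t x) (\<lambda>y. \<bar>f y * indicator (- N x) y\<bar>)"
      unfolding eq[OF t] by (rule integral_abs_bound)
    also have "\<dots> \<le> measure_pmf.expectation (P t x) (\<lambda>y. C * indicator (- N x) y)"
    proof (rule integral_mono)
      show "integrable (measure_pmf (P t x)) (\<lambda>y. \<bar>f y * indicator (- N x) y\<bar>)"
        by (rule integrable_abs, rule if1)
      show "integrable (measure_pmf (P t x)) (\<lambda>y. C * indicator (- N x) y)"
        by (rule pmf_integrable_bounded[where C = C])
          (use bound_nonneg[OF f] in \<open>auto simp: indicator_def\<close>)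
      show "\<bar>f y * indicator (- N x) y\<bar> \<le> C * indicator (- N x) y" for y
        using f[of y] by (auto simp: indicator_def)
    qed
    also have "\<dots> = C * (1 - measure (P t x) (N x))"
      using measure_pmf.prob_compl[of "N x" "P t x"] by (simp add: Compl_eq_Diff_UNIV)
    finally have "\<bar>E t f x - f x - t * A t\<bar> / t \<le> C * (1 - measure (P t x) (N x)) / t"
      using t by (intro divide_right_mono) auto
    moreover have "(E t f x - f x) / t - A t = (E t f x - f x - t * A t) / t"
      using t by (simp add: field_simps)
    ultimately show ?thesis using t by (simp add: abs_divide)
  qed
  have "((\<lambda>t. (E t f x - f x) / t - A t) \<longlongrightarrow> 0) (at_right 0)"
  proof (rule Lim_null_comparison)
    show "((\<lambda>t. C * ((1 - measure (P t x) (N x)) / t)) \<longlongrightarrow> 0) (at_right 0)"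
      using tendsto_mult_right_zero[OF mass_outside_N] by simp
    show "\<forall>\<^sub>F t in at_right 0. norm ((E t f x - f x) / t - A t) \<le> C * ((1 - measure (P t x) (N x)) / t)"
      using bound by (auto simp: eventually_at_right_less eventually_at intro!: exI[of _ 1])
  qed
  from tendsto_add[OF this A] show ?thesis by simp
qed

lemma E_lipschitz:
  assumes f: "\<And>y. \<bar>f y\<bar> \<le> C" and "s \<ge> 0" "t \<ge> 0"
  shows "\<bar>E s f x - E t f x\<bar> \<le> 2 * C * \<Lambda> * \<bar>s - t\<bar>"
  using assms(2,3)
proof (induction s t rule: linorder_wlog)
  case (le s t)
  have "E t f x = E s (E (t - s) f) x"
    using E_add[of s "t - s" f C x] le f by simp
  then have "E t f x - E s f x = E s (\<lambda>y. E (t - s) f y - f y) x"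
    by (subst E_diff[OF abs_E_le[OF f] f]) simp
  moreover have "\<bar>\<dots>\<bar> \<le> 2 * C * \<Lambda> * (t - s)"
    by (rule abs_E_le, rule E_increment_le) (use f le in auto)
  ultimately show ?case using le by (simp add: abs_minus_commute)
next
  case (sym s t)
  then show ?case by (simp add: abs_minus_commute)
qed

lemma L_bounded:
  assumes f: "\<And>y. \<bar>f y\<bar> \<le> C"
  shows "\<bar>L f y\<bar> \<le> 2 * C * \<Lambda>"
proof (rule tendsto_upperbound)
  show "((\<lambda>t. \<bar>(E t f y - f y) / t\<bar>) \<longlongrightarrow> \<bar>L f y\<bar>) (at_right 0)"
    by (intro tendsto_intros E_generator[OF f])
  show "\<forall>\<^sub>F t in at_right 0. \<bar>(E t f y - f y) / t\<bar> \<le> 2 * C * \<Lambda>"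
    using E_increment_le[of f C _ y, OF f]
    by (auto simp: eventually_at abs_divide divide_le_eq intro!: exI[of _ 1])
qed auto

text \<open>Kolmogorov's forward equation in weak form. The difference quotient at \<open>t\<close> is the expectation,
  at the earlier of the two times, of a difference quotient at \<open>0\<close>; the latter is bounded uniformly in
  the state and converges pointwise to the generator, so dominated convergence applies.\<close>

lemma E_has_derivative:
  assumes f: "\<And>y. \<bar>f y\<bar> \<le> C" and t: "t \<ge> 0"
  shows "((\<lambda>t. E t f x) has_real_derivative E t (L f) x) (at t within {0..})"
  unfolding has_field_derivative_iff tendsto_at_iff_sequentially comp_def
proof (intro allI impI)
  fix s :: "nat \<Rightarrow> real"
  assume s: "\<forall>n. s n \<in> {0..} - {t}" and lim: "s \<longlonglongrightarrow> t"
  define h where "h n = \<bar>s n - t\<bar>" for n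
  define m where "m n = min (s n) t" for n
  define F where "F n y = (E (h n) f y - f y) / h n" for n y
  have h0: "h n > 0" for n using s by (auto simp: h_def)
  have m0: "m n \<ge> 0" for n using s t by (auto simp: m_def)
  have "h \<longlonglongrightarrow> \<bar>t - t\<bar>" unfolding h_def by (intro tendsto_intros lim)
  then have h_lim: "filterlim h (at_right 0) sequentially"
    using h0 by (auto simp: filterlim_at less_imp_neq[symmetric] intro!: always_eventually)
  have F_bound: "\<bar>F n y\<bar> \<le> 2 * C * \<Lambda>" for n y
    using E_increment_le[of f C "h n" y, OF f] h0[of n]
    by (simp add: F_def abs_divide divide_le_eq)
  have F_lim: "(\<lambda>n. F n y) \<longlonglongrightarrow> L f y" for y
    unfolding F_def by (rule filterlim_compose[OF E_generator[OF f] h_lim])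
  have quot: "(E (s n) f x - E t f x) / (s n - t) = E (m n) (F n) x" for n
  proof -
    have "E (m n) (F n) x = (E (m n) (E (h n) f) x - E (m n) f x) / h n"
      unfolding F_def E_diff[OF abs_E_le[OF f] f, symmetric] by (simp add: E_def)
    also have "E (m n) (E (h n) f) x = E (m n + h n) f x"
      by (rule E_add[symmetric]) (use m0 h0 f in \<open>auto intro: less_imp_le\<close>)
    also have "(E (m n + h n) f x - E (m n) f x) / h n = (E (s n) f x - E t f x) / (s n - t)"
      using h0[of n] by (cases "s n \<le> t") (auto simp: h_def m_def field_simps)
    finally show ?thesis by simp
  qed
  have lim1: "(\<lambda>n. E t (F n) x) \<longlonglongrightarrow> E t (L f) x"
    unfolding E_def
    by (rule integral_dominated_convergence[where w = "\<lambda>_. 2 * C * \<Lambda>"])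
      (use F_bound F_lim in auto)
  have "m \<longlonglongrightarrow> min t t" unfolding m_def by (intro tendsto_intros lim)
  then have m_lim: "(\<lambda>n. 2 * (2 * C * \<Lambda>) * \<Lambda> * \<bar>m n - t\<bar>) \<longlonglongrightarrow> 2 * (2 * C * \<Lambda>) * \<Lambda> * \<bar>t - t\<bar>"
    by (intro tendsto_intros) simp
  have "(\<lambda>n. E (m n) (F n) x - E t (F n) x) \<longlonglongrightarrow> 0"
  proof (rule Lim_null_comparison)
    show "(\<lambda>n. 2 * (2 * C * \<Lambda>) * \<Lambda> * \<bar>m n - t\<bar>) \<longlonglongrightarrow> 0" using m_lim by simp
    show "\<forall>\<^sub>F n in sequentially. norm (E (m n) (F n) x - E t (F n) x) \<le> 2 * (2 * C * \<Lambda>) * \<Lambda> * \<bar>m n - t\<bar>"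
      unfolding real_norm_def
      by (rule always_eventually, rule allI, rule E_lipschitz) (use F_bound m0 t in auto)
  qed
  from tendsto_add[OF this lim1]
  show "(\<lambda>n. (E (s n) f x - E t f x) / (s n - t)) \<longlonglongrightarrow> E t (L f) x"
    by (simp add: quot)
qed

lemma E_continuous:
  assumes f: "\<And>y. \<bar>f y\<bar> \<le> C"
  shows "continuous_on {0..} (\<lambda>t. E t f x)"
  using E_has_derivative[OF f] by (intro DERIV_continuous_on) auto

lemma E_has_integral:
  assumes f: "\<And>y. \<bar>f y\<bar> \<le> C" and "T \<ge> 0"
  shows "((\<lambda>t. E t (L f) x) has_integral (E T f x - f x)) {0..T}"
proof -
  have "((\<lambda>t. E t (L f) x) has_integral (E T f x - E 0 f x)) {0..T}"
  proof (rule fundamental_theorem_of_calculus)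
    fix t assume "t \<in> {0..T}"
    then have "((\<lambda>t. E t f x) has_real_derivative E t (L f) x) (at t within {0..T})"
      by (intro DERIV_subset[OF E_has_derivative[OF f]]) auto
    then show "((\<lambda>t. E t f x) has_vector_derivative E t (L f) x) (at t within {0..T})"
      by (simp add: has_real_derivative_iff_has_vector_derivative)
  qed (use assms in auto)
  then show ?thesis by (simp add: E_0)
qed

text \<open>The occupation measure: \<open>occupation x T\<close> gives to \<open>y\<close> the expected time that the chain started
  in \<open>x\<close> spends in \<open>y\<close> up to time \<open>T\<close>. Its total mass is \<open>T\<close>.\<close>

definition occupation :: "'s \<Rightarrow> real \<Rightarrow> 's measure" where
  "occupation x T = density (count_space UNIV)
    (\<lambda>y. \<integral>\<^sup>+t\<in>{0..T}. ennreal (pmf (P t x) y) \<partial>lborel)"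

lemma space_occupation [simp]: "space (occupation x T) = UNIV"
  and sets_occupation [simp, measurable_cong]: "sets (occupation x T) = UNIV"
  by (auto simp: occupation_def)

lemma borel_measurable_occupation [simp]: "f \<in> borel_measurable (occupation x T)"
  by (rule measurableI) simp_all

lemma pmf_measurable: "(\<lambda>t. ennreal (pmf (P t x) y) * indicator {0..T} t) \<in> borel_measurable borel"
proof -
  have "pmf (P t x) y = E t (indicator {y}) x" for t
    by (simp add: E_def measure_pmf_single)
  then have "continuous_on {0..} (\<lambda>t. pmf (P t x) y)"
    using E_continuous[of "indicator {y}" 1 x] by (simp add: indicator_def)
  then have "continuous_on {0..T} (\<lambda>t. pmf (P t x) y)"
    by (rule continuous_on_subset) auto
  then have "(\<lambda>t. indicator {0..T} t *\<^sub>R pmf (P t x) y) \<in> borel_measurable borel"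
    by (intro borel_measurable_continuous_on_indicator) auto
  then have "(\<lambda>t. ennreal (indicator {0..T} t *\<^sub>R pmf (P t x) y)) \<in> borel_measurable borel"
    by measurable
  also have "(\<lambda>t. ennreal (indicator {0..T} t *\<^sub>R pmf (P t x) y)) =
      (\<lambda>t. ennreal (pmf (P t x) y) * indicator {0..T} t)"
    by (auto simp: indicator_def fun_eq_iff)
  finally show ?thesis .
qed

lemma nn_integral_occupation:
  "(\<integral>\<^sup>+y. f y \<partial>occupation x T) = (\<integral>\<^sup>+t\<in>{0..T}. (\<integral>\<^sup>+y. f y \<partial>measure_pmf (P t x)) \<partial>lborel)"
proof -
  have [measurable]: "(\<lambda>t. ennreal (pmf (P t x) y) * indicator {0..T} t) \<in> borel_measurable borel" for y
    by (rule pmf_measurable)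
  interpret pair_sigma_finite "count_space (UNIV :: 's set)" lborel
    by (intro pair_sigma_finite.intro sigma_finite_measure_count_space lborel.sigma_finite_measure_axioms)
  have meas: "(\<lambda>(y, t). f y * (ennreal (pmf (P t x) y) * indicator {0..T} t))
      \<in> borel_measurable (count_space UNIV \<Otimes>\<^sub>M lborel)"
    by (rule measurable_pair_measure_countable1) auto
  have "(\<integral>\<^sup>+y. f y \<partial>occupation x T) =
      (\<integral>\<^sup>+y. (\<integral>\<^sup>+t. ennreal (pmf (P t x) y) * indicator {0..T} t \<partial>lborel) * f y \<partial>count_space UNIV)"
    unfolding occupation_def by (subst nn_integral_density) auto
  also have "\<dots> = (\<integral>\<^sup>+y. (\<integral>\<^sup>+t. f y * (ennreal (pmf (P t x) y) * indicator {0..T} t) \<partial>lborel) \<partial>count_space UNIV)"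
    by (subst nn_integral_cmult) (auto simp: mult.commute[of "f _"])
  also have "\<dots> = (\<integral>\<^sup>+t. (\<integral>\<^sup>+y. f y * (ennreal (pmf (P t x) y) * indicator {0..T} t) \<partial>count_space UNIV) \<partial>lborel)"
    by (rule Fubini'[OF meas, symmetric])
  also have "\<dots> = (\<integral>\<^sup>+t. (\<integral>\<^sup>+y. ennreal (pmf (P t x) y) * f y \<partial>count_space UNIV) * indicator {0..T} t \<partial>lborel)"
    by (intro nn_integral_cong) (auto simp: indicator_def mult.commute)
  also have "\<dots> = (\<integral>\<^sup>+t\<in>{0..T}. (\<integral>\<^sup>+y. f y \<partial>measure_pmf (P t x)) \<partial>lborel)"
    by (simp add: nn_integral_measure_pmf)
  finally show ?thesis .
qed

lemma emeasure_occupation_UNIV: "T \<ge> 0 \<Longrightarrow> emeasure (occupation x T) UNIV = ennreal T"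
  using nn_integral_occupation[of x T "\<lambda>_. 1"] by (simp add: nn_integral_cmult_indicator)

lemma finite_measure_occupation: "T \<ge> 0 \<Longrightarrow> finite_measure (occupation x T)"
  by (rule finite_measureI) (simp add: emeasure_occupation_UNIV)

lemma integral_occupation:
  assumes f: "\<And>y. \<bar>f y\<bar> \<le> C" and T: "T \<ge> 0"
    and I: "((\<lambda>t. E t f x) has_integral I) {0..T}"
  shows "(\<integral>y. f y \<partial>occupation x T) = I"
proof -
  interpret finite_measure "occupation x T" using T by (rule finite_measure_occupation)
  have fi: "integrable (occupation x T) f"
    by (rule integrable_const_bound[where B = C]) (use f in auto)
  have pi: "integrable (measure_pmf p) f" for p by (rule pmf_integrable_bounded[OF f])
  have C: "0 \<le> f y + C" for y using f[of y] by linarith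
  have E: "0 \<le> E t f x + C" for t using abs_E_le[of f C t x, OF f] by linarith
  have "((\<lambda>t. E t f x + C) has_integral I + C * T) {0..T}"
    using has_integral_add[OF I has_integral_const_real[of C 0 T]] T by (simp add: mult.commute)
  from nn_integral_has_integral_lebesgue'[OF E this]
  have "(\<integral>\<^sup>+t. ennreal (E t f x + C) * indicator {0..T} t \<partial>lborel) = ennreal (I + C * T)" .
  moreover have "ennreal (E t f x + C) = (\<integral>\<^sup>+y. ennreal (f y + C) \<partial>measure_pmf (P t x))" for t
    by (subst nn_integral_eq_integral)
      (use C pi in \<open>auto simp: E_def\<close>)
  ultimately have "(\<integral>\<^sup>+y. ennreal (f y + C) \<partial>occupation x T) = ennreal (I + C * T)"
    by (simp add: nn_integral_occupation)
  moreover have "(\<integral>\<^sup>+y. ennreal (f y + C) \<partial>occupation x T) = ennreal ((\<integral>y. f y + C \<partial>occupation x T))"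
    by (rule nn_integral_eq_integral) (use C fi in auto)
  moreover have "(\<integral>y. f y + C \<partial>occupation x T) = (\<integral>y. f y \<partial>occupation x T) + C * T"
    using fi T by (simp add: measure_def emeasure_occupation_UNIV mult.commute)
  moreover have "0 \<le> (\<integral>y. f y + C \<partial>occupation x T)" by (rule Bochner_Integration.integral_nonneg) (use C in auto)
  moreover have "0 \<le> I + C * T"
    by (rule has_integral_nonneg[OF \<open>((\<lambda>t. E t f x + C) has_integral I + C * T) {0..T}\<close>]) (use E in auto)
  ultimately show ?thesis by simp
qed

lemma Dynkin_bounded:
  assumes f: "\<And>y. \<bar>f y\<bar> \<le> C" and T: "T \<ge> 0"
  shows "(\<integral>y. f y \<partial>measure_pmf (P T x)) - f x = (\<integral>y. L f y \<partial>occupation x T)"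
  using integral_occupation[OF L_bounded[OF f] T E_has_integral[OF f T]] by (simp add: E_def)

end

section \<open>Dynkin's formula and recurrence under a drift condition\<close>

lemma Fatou_bounded_integrals:
  fixes f :: "nat \<Rightarrow> 'a \<Rightarrow> real"
  assumes f: "\<And>n. integrable M (f n)" "\<And>n x. 0 \<le> f n x" "\<And>n. (\<integral>x. f n x \<partial>M) \<le> B"
    and lim: "\<And>x. (\<lambda>n. f n x) \<longlonglongrightarrow> g x" and g: "g \<in> borel_measurable M"
  shows "integrable M g" "(\<integral>x. g x \<partial>M) \<le> B"
proof -
  have g0: "0 \<le> g x" for x by (rule LIMSEQ_le_const[OF lim]) (use f(2) in blast)
  have B: "0 \<le> B" by (rule order_trans[OF Bochner_Integration.integral_nonneg f(3)[of 0]]) (use f(2) in auto)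
  have "(\<integral>\<^sup>+x. ennreal (g x) \<partial>M) = (\<integral>\<^sup>+x. liminf (\<lambda>n. ennreal (f n x)) \<partial>M)"
    by (intro nn_integral_cong lim_imp_Liminf[symmetric] tendsto_ennrealI lim) auto
  also have "\<dots> \<le> liminf (\<lambda>n. \<integral>\<^sup>+x. ennreal (f n x) \<partial>M)"
    by (rule nn_integral_liminf) (use f(1) in auto)
  also have "\<dots> \<le> liminf (\<lambda>n. ennreal B)"
    by (intro Liminf_mono always_eventually allI)
      (use f in \<open>auto simp: nn_integral_eq_integral intro!: ennreal_leI\<close>)
  also have "\<dots> = ennreal B" by (simp add: Liminf_const)
  finally have *: "(\<integral>\<^sup>+x. ennreal (g x) \<partial>M) \<le> ennreal B" .
  show "integrable M g"
    using * g0 g by (intro integrableI_nonneg) (auto simp: less_top[symmetric] top_unique)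
  then show "(\<integral>x. g x \<partial>M) \<le> B"
    using * g0 B by (simp add: nn_integral_eq_integral)
qed

text \<open>In addition the rates satisfy a geometric drift condition towards the single state \<open>z\<close>.\<close>

locale Lyapunov_semigroup = bounded_rate_semigroup P Q N \<Lambda>
  for P :: "real \<Rightarrow> 's::countable \<Rightarrow> 's pmf" and Q N \<Lambda> +
  fixes W :: "'s \<Rightarrow> real" and z :: 's and c b :: real
  assumes Q_nonneg: "x \<noteq> y \<Longrightarrow> 0 \<le> Q x y"
    and W_ge_1: "1 \<le> W x"
    and c_pos: "0 < c" and b_nonneg: "0 \<le> b"
    and drift: "L W x \<le> - c * W x + b * of_bool (x = z)"
begin

lemma L_const: "L (\<lambda>y. k) x = 0"
  using Q_conservative[of x] by (simp add: L_def flip: sum_distrib_right)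

lemma L_mono_at:
  assumes "f x = g x" "\<And>y. f y \<le> g y"
  shows "L f x \<le> L g x"
  unfolding L_def
  by (rule sum_mono, rename_tac y, case_tac "y = x")
    (use assms Q_nonneg in \<open>auto intro!: mult_left_mono\<close>)

lemma L_weighted_bound:
  assumes "\<And>y. \<bar>f y\<bar> \<le> C * W y"
  shows "\<bar>L f x\<bar> \<le> C * (b + 2 * \<Lambda>) * W x"
proof -
  have C: "0 \<le> C" using assms[of x] W_ge_1[of x]
    by (smt (verit) mult_less_0_iff)
  have "\<bar>L f x\<bar> \<le> (\<Sum>y\<in>N x. \<bar>Q x y * f y\<bar>)" unfolding L_def by (rule sum_abs)
  also have "\<dots> \<le> (\<Sum>y\<in>N x. \<bar>Q x y\<bar> * (C * W y))"
    by (rule sum_mono) (simp add: abs_mult assms mult_left_mono)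
  also have "\<dots> = C * (\<Sum>y\<in>N x. \<bar>Q x y\<bar> * W y)"
    by (simp add: sum_distrib_left mult_ac)
  also have "(\<Sum>y\<in>N x. \<bar>Q x y\<bar> * W y) \<le> (\<Sum>y\<in>N x. Q x y * W y + (if y = x then 2 * \<Lambda> * W x else 0))"
  proof (rule sum_mono)
    fix y
    have "\<bar>Q x x\<bar> \<le> Q x x + 2 * \<Lambda>" using exit_rate_le[of x] \<Lambda>_nonneg by linarith
    then have "\<bar>Q x x\<bar> * W x \<le> (Q x x + 2 * \<Lambda>) * W x"
      using W_ge_1[of x] by (intro mult_right_mono) auto
    then show "\<bar>Q x y\<bar> * W y \<le> Q x y * W y + (if y = x then 2 * \<Lambda> * W x else 0)"
      using Q_nonneg[of x y] by (auto simp: algebra_simps)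
  qed
  also have "\<dots> = L W x + 2 * \<Lambda> * W x"
    using finite_N self_in_N by (simp add: sum.distrib L_def)
  also have "\<dots> \<le> (b + 2 * \<Lambda>) * W x"
  proof -
    have "b * of_bool (x = z) \<le> b * W x"
      using b_nonneg W_ge_1[of x] by (intro mult_left_mono) auto
    moreover have "0 \<le> c * W x" using c_pos W_ge_1[of x] by simp
    ultimately show ?thesis using drift[of x] by (simp add: algebra_simps)
  qed
  finally show ?thesis using C by (simp add: mult_left_mono mult.assoc)
qed

text \<open>Truncating \<open>W\<close> at \<open>k\<close> makes it bounded and keeps the drift inequality on \<open>{W \<le> k}\<close>, since a
  truncation only lowers the values at the neighbours; where \<open>W > k\<close> the truncation is at its maximum,
  so that its generator is at most \<open>0\<close>.\<close>

lemma L_truncation_le: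
  "L (\<lambda>y. min (W y) k) x \<le> b * of_bool (x = z) - c * (W x * of_bool (W x \<le> k))"
proof (cases "W x \<le> k")
  case True
  then have "L (\<lambda>y. min (W y) k) x \<le> L W x" by (intro L_mono_at) auto
  then show ?thesis using drift[of x] True by simp
next
  case False
  then have "L (\<lambda>y. min (W y) k) x \<le> L (\<lambda>y. k) x" by (intro L_mono_at) auto
  also have "\<dots> = 0" by (rule L_const)
  also have "0 \<le> b * of_bool (x = z)" using b_nonneg by simp
  finally show ?thesis using False by simp
qed

lemma integrable_occupation_bounded:
  assumes "T \<ge> 0" "\<And>y. \<bar>f y\<bar> \<le> C"
  shows "integrable (occupation x T) (f :: 's \<Rightarrow> real)"
proof -
  interpret finite_measure "occupation x T" using assms(1) by (rule finite_measure_occupation)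
  show ?thesis by (rule integrable_const_bound[where B = C]) (use assms in auto)
qed

lemma integral_indicator_occupation:
  "(\<integral>y. of_bool (y = w) \<partial>occupation x T) = measure (occupation x T) {w}"
proof -
  have "(\<integral>y. of_bool (y = w) \<partial>occupation x T) = (\<integral>y. (indicator {w} y :: real) \<partial>occupation x T)"
    by (rule Bochner_Integration.integral_cong) (auto simp: indicator_def)
  then show ?thesis by (simp only: Bochner_Integration.integral_indicator space_occupation Int_UNIV_right)
qed

lemma truncated_drift:
  assumes T: "T \<ge> 0" and k: "k \<ge> 0"
  shows "measure_pmf.expectation (P T x) (\<lambda>y. min (W y) k)
      + c * (\<integral>y. W y * of_bool (W y \<le> k) \<partial>occupation x T)
    \<le> W x + b * measure (occupation x T) {z}"
proof -
  have W0: "0 \<le> W y" for y using W_ge_1[of y] by linarith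
  have f: "\<bar>min (W y) k\<bar> \<le> k" for y using W_ge_1[of y] k by simp
  have i1: "integrable (occupation x T) (\<lambda>y. b * of_bool (y = z))"
    by (rule integrable_occupation_bounded[OF T, where C = b]) (use b_nonneg in auto)
  have i2: "integrable (occupation x T) (\<lambda>y. c * (W y * of_bool (W y \<le> k)))"
    by (rule integrable_occupation_bounded[OF T, where C = "c * k"])
      (use W0 c_pos k in \<open>auto simp: abs_mult\<close>)
  have "measure_pmf.expectation (P T x) (\<lambda>y. min (W y) k) - min (W x) k =
      (\<integral>y. L (\<lambda>y. min (W y) k) y \<partial>occupation x T)"
    by (rule Dynkin_bounded[OF f T])
  also have "\<dots> \<le> (\<integral>y. b * of_bool (y = z) - c * (W y * of_bool (W y \<le> k)) \<partial>occupation x T)"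
    by (intro integral_mono L_truncation_le Bochner_Integration.integrable_diff i1 i2
        integrable_occupation_bounded[OF T L_bounded[OF f]])
  also have "\<dots> = b * measure (occupation x T) {z} - c * (\<integral>y. W y * of_bool (W y \<le> k) \<partial>occupation x T)"
    by (subst Bochner_Integration.integral_diff[OF i1 i2])
      (simp add: integral_indicator_occupation)
  finally show ?thesis by (simp add: min_def split: if_splits)
qed

lemma
  assumes T: "T \<ge> 0"
  shows integrable_W_occupation: "integrable (occupation x T) W"
    and integral_W_occupation_le: "c * (\<integral>y. W y \<partial>occupation x T) \<le> W x + b * measure (occupation x T) {z}"
    and integrable_W: "integrable (measure_pmf (P T x)) W"
proof -
  have W0: "0 \<le> W y" for y using W_ge_1[of y] by linarith
  define B where "B = W x + b * measure (occupation x T) {z}"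
  have tail: "eventually (\<lambda>n. W y \<le> real n) sequentially" for y
    by (rule eventually_sequentiallyI[of "nat \<lceil>W y\<rceil>"]) linarith
  have 1: "c * (\<integral>y. W y * of_bool (W y \<le> real n) \<partial>occupation x T) \<le> B" for n
    using truncated_drift[OF T, of "real n" x] W0
    by (smt (verit) B_def Bochner_Integration.integral_nonneg min_def of_nat_0_le_iff)
  have 2: "measure_pmf.expectation (P T x) (\<lambda>y. min (W y) (real n)) \<le> B" for n
  proof -
    have "0 \<le> (\<integral>y. W y * of_bool (W y \<le> real n) \<partial>occupation x T)"
      by (rule Bochner_Integration.integral_nonneg) (use W0 in auto)
    then have "0 \<le> c * (\<integral>y. W y * of_bool (W y \<le> real n) \<partial>occupation x T)"
      using c_pos by simp
    then show ?thesis using truncated_drift[OF T, of "real n" x] unfolding B_def by linarith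
  qed
  have i1: "integrable (occupation x T) (\<lambda>y. W y * of_bool (W y \<le> real n))" for n
    by (rule integrable_occupation_bounded[OF T, where C = "real n"]) (use W0 in auto)
  have lim1: "(\<lambda>n. W y * of_bool (W y \<le> real n)) \<longlonglongrightarrow> W y" for y
    by (rule tendsto_eventually) (use tail[of y] in eventually_elim, simp)
  have lim2: "(\<lambda>n. min (W y) (real n)) \<longlonglongrightarrow> W y" for y
    by (rule tendsto_eventually) (use tail[of y] in eventually_elim, simp)
  have 3: "(\<integral>y. W y * of_bool (W y \<le> real n) \<partial>occupation x T) \<le> B / c" for n
    using 1[of n] c_pos by (simp add: field_simps)
  show "integrable (occupation x T) W"
    by (rule Fatou_bounded_integrals(1)[OF i1 _ 3 lim1]) (use W0 in auto)
  have "(\<integral>y. W y \<partial>occupation x T) \<le> B / c"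
    by (rule Fatou_bounded_integrals(2)[OF i1 _ 3 lim1]) (use W0 in auto)
  then show "c * (\<integral>y. W y \<partial>occupation x T) \<le> W x + b * measure (occupation x T) {z}"
    using c_pos by (simp add: B_def field_simps)
  have i2: "integrable (measure_pmf (P T x)) (\<lambda>y. min (W y) (real n))" for n
    by (rule pmf_integrable_bounded[where C = "real n"]) (use W0 in \<open>auto simp: abs_of_nonneg\<close>)
  show "integrable (measure_pmf (P T x)) W"
    by (rule Fatou_bounded_integrals(1)[OF i2 _ 2 lim2]) (use W0 in auto)
qed

lemma integrable_weighted:
  assumes "T \<ge> 0" and u: "\<And>y. \<bar>u y\<bar> \<le> C * W y"
  shows "integrable (measure_pmf (P T x)) u" "integrable (occupation x T) u"
proof -
  have *: "norm (u y) \<le> norm (C * W y)" for y using u[of y] by simp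
  show "integrable (measure_pmf (P T x)) u"
    by (rule Bochner_Integration.integrable_bound[OF integrable_mult_right[OF integrable_W[OF assms(1)]]]) (use * in auto)
  show "integrable (occupation x T) u"
    by (rule Bochner_Integration.integrable_bound[OF integrable_mult_right[OF integrable_W_occupation[OF assms(1)]]]) (use * in auto)
qed

lemma Dynkin_weighted:
  assumes T: "T \<ge> 0" and u: "\<And>y. \<bar>u y\<bar> \<le> C * W y"
  shows "measure_pmf.expectation (P T x) u - u x = (\<integral>y. L u y \<partial>occupation x T)"
proof -
  define v where "v n y = max (- real n) (min (real n) (u y))" for n y
  have v_n: "\<bar>v n y\<bar> \<le> real n" for n y by (auto simp: v_def)
  have v_u: "\<bar>v n y\<bar> \<le> C * W y" for n y using u[of y] by (auto simp: v_def)
  have v_lim: "(\<lambda>n. v n y) \<longlonglongrightarrow> u y" for y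
  proof (rule tendsto_eventually)
    show "\<forall>\<^sub>F n in sequentially. v n y = u y"
      by (rule eventually_sequentiallyI[of "nat \<lceil>\<bar>u y\<bar>\<rceil>"]) (unfold v_def, linarith)
  qed
  have L_lim: "(\<lambda>n. L (v n) y) \<longlonglongrightarrow> L u y" for y
    unfolding L_def by (intro tendsto_intros v_lim)
  have "(\<lambda>n. measure_pmf.expectation (P T x) (v n) - v n x) \<longlonglongrightarrow>
      measure_pmf.expectation (P T x) u - u x"
    by (intro tendsto_diff v_lim integral_dominated_convergence[where w = "\<lambda>y. C * W y"])
      (use v_u v_lim integrable_W[OF T] in auto)
  moreover have "(\<lambda>n. \<integral>y. L (v n) y \<partial>occupation x T) \<longlonglongrightarrow> (\<integral>y. L u y \<partial>occupation x T)"
    by (intro integral_dominated_convergence[where w = "\<lambda>y. C * (b + 2 * \<Lambda>) * W y"])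
      (use L_weighted_bound[OF v_u] L_lim integrable_W_occupation[OF T] in auto)
  moreover have "measure_pmf.expectation (P T x) (v n) - v n x = (\<integral>y. L (v n) y \<partial>occupation x T)" for n
    by (rule Dynkin_bounded[OF v_n T])
  ultimately show ?thesis by (simp add: LIMSEQ_unique)
qed

text \<open>As \<open>W \<ge> 1\<close>, the drift forces the chain to spend a positive fraction of its time in \<open>z\<close>.\<close>

lemma occupation_base_ge:
  assumes T: "T \<ge> 0"
  shows "c * T \<le> W x + b * measure (occupation x T) {z}"
proof -
  interpret finite_measure "occupation x T" using T by (rule finite_measure_occupation)
  have "T = (\<integral>y. 1 \<partial>occupation x T)"
    using T by (simp add: measure_def emeasure_occupation_UNIV)
  also have "\<dots> \<le> (\<integral>y. W y \<partial>occupation x T)"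
    by (rule integral_mono) (use W_ge_1 integrable_W_occupation[OF T] in auto)
  finally have "c * T \<le> c * (\<integral>y. W y \<partial>occupation x T)" using c_pos by simp
  then show ?thesis using integral_W_occupation_le[OF T, of x] by linarith
qed

text \<open>Dynkin's formula for the indicator of \<open>y\<close> balances the expected number of jumps into \<open>y\<close>
  against the expected number of jumps out of \<open>y\<close>.\<close>

lemma occupation_step:
  assumes T: "T \<ge> 0" and wy: "w \<noteq> y"
  shows "measure (occupation x T) {w} * Q w y \<le> \<Lambda> * measure (occupation x T) {y} + 1"
proof -
  interpret finite_measure "occupation x T" using T by (rule finite_measure_occupation)
  define f :: "'s \<Rightarrow> real" where "f v = of_bool (v = y)" for v
  have f: "\<bar>f v\<bar> \<le> 1" for v by (simp add: f_def)
  have Lf: "L f v = Q v y" for v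
    using finite_N[of v] Q_outside[of y v] by (simp add: L_def f_def of_bool_def if_distrib cong: if_cong)
  have i: "integrable (occupation x T) (\<lambda>v. of_bool (v = v') * a)" for v' and a :: real
    by (rule integrable_occupation_bounded[OF T, where C = "\<bar>a\<bar>"]) auto
  have int: "(\<integral>v. of_bool (v = v') * a \<partial>occupation x T) = measure (occupation x T) {v'} * a" for v' and a :: real
    by (simp add: integral_indicator_occupation)
  have "measure (occupation x T) {w} * Q w y - measure (occupation x T) {y} * \<Lambda> =
      (\<integral>v. of_bool (v = w) * Q w y - of_bool (v = y) * \<Lambda> \<partial>occupation x T)"
    by (subst Bochner_Integration.integral_diff[OF i i]) (simp only: int)
  also have "\<dots> \<le> (\<integral>v. L f v \<partial>occupation x T)"
  proof (rule integral_mono)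
    show "integrable (occupation x T) (\<lambda>v. L f v)"
      by (rule integrable_occupation_bounded[OF T L_bounded[OF f]])
    show "of_bool (v = w) * Q w y - of_bool (v = y) * \<Lambda> \<le> L f v" for v
      using Q_nonneg[of v y] exit_rate_le[of y] wy unfolding Lf by (cases "v = y"; cases "v = w") auto
  qed (intro Bochner_Integration.integrable_diff i)
  also have "\<dots> = measure_pmf.expectation (P T x) f - f x"
    by (rule Dynkin_bounded[OF f T, symmetric])
  also have "\<dots> \<le> 1"
    using abs_pmf_expectation_le[of f 1 "P T x", OF f] f_def[of x] by (smt (verit) of_bool_def)
  finally show ?thesis by (simp add: mult.commute)
qed

lemma occupation_reachable:
  assumes "(\<lambda>w y. w \<noteq> y \<and> 0 < Q w y)\<^sup>*\<^sup>* z y"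
  shows "\<exists>A>0. \<forall>T\<ge>0. \<forall>x. measure (occupation x T) {z} \<le> A * (measure (occupation x T) {y} + 1)"
  using assms
proof (induction rule: rtranclp_induct)
  case base
  show ?case by (intro exI[of _ 1]) auto
next
  case (step w y)
  then obtain A where A: "A > 0"
    "\<And>T x. T \<ge> 0 \<Longrightarrow> measure (occupation x T) {z} \<le> A * (measure (occupation x T) {w} + 1)"
    by blast
  define q where "q = Q w y"
  have q: "q > 0" and wy: "w \<noteq> y" using step.hyps by (auto simp: q_def)
  define D where "D = (\<Lambda> + 1) / q + 1"
  have D: "D > 0" using q \<Lambda>_nonneg by (simp add: D_def add_nonneg_pos)
  show ?case
  proof (intro exI[of _ "A * D"] conjI allI impI)
    fix T :: real and x assume T: "T \<ge> 0"
    let ?y = "measure (occupation x T) {y}"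
    have "measure (occupation x T) {w} \<le> (\<Lambda> * ?y + 1) / q"
      using occupation_step[OF T wy, of x] q by (simp add: q_def field_simps)
    also have "\<dots> \<le> ((\<Lambda> + 1) * (?y + 1)) / q"
      using q \<Lambda>_nonneg by (intro divide_right_mono) (auto simp: algebra_simps)
    finally have "measure (occupation x T) {w} + 1 \<le> D * (?y + 1)"
      unfolding D_def distrib_right times_divide_eq_left by (simp add: add_increasing2)
    then have "A * (measure (occupation x T) {w} + 1) \<le> A * (D * (?y + 1))"
      using A(1) by (intro mult_left_mono) auto
    then show "measure (occupation x T) {z} \<le> A * D * (?y + 1)"
      using A(2)[OF T, of x] by (simp add: mult.assoc)
  qed (use A(1) D in auto)
qed

text \<open>Positive recurrence: every state reachable from \<open>z\<close> receives occupation time that grows at least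
  linearly.\<close>

lemma occupation_grows:
  assumes "(\<lambda>w y. w \<noteq> y \<and> 0 < Q w y)\<^sup>*\<^sup>* z y"
  obtains \<epsilon> D where "\<epsilon> > 0" "\<And>T. T \<ge> 0 \<Longrightarrow> \<epsilon> * T - D \<le> measure (occupation x T) {y}"
proof -
  obtain A where A: "A > 0"
    "\<And>T x. T \<ge> 0 \<Longrightarrow> measure (occupation x T) {z} \<le> A * (measure (occupation x T) {y} + 1)"
    using occupation_reachable[OF assms] by blast
  define K where "K = (b + 1) * A"
  have K: "K > 0" using b_nonneg A(1) by (simp add: K_def)
  show ?thesis
  proof (rule that[of "c / K" "W x / K + 1"])
    fix T :: real assume T: "T \<ge> 0"
    have "c * T \<le> W x + b * measure (occupation x T) {z}" by (rule occupation_base_ge[OF T])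
    also have "\<dots> \<le> W x + (b + 1) * (A * (measure (occupation x T) {y} + 1))"
      using A(2)[OF T, of x] b_nonneg by (intro add_left_mono mult_mono) auto
    finally have "c * T / K \<le> (W x + K * (measure (occupation x T) {y} + 1)) / K"
      using K by (intro divide_right_mono) (auto simp: K_def mult.assoc)
    then show "c / K * T - (W x / K + 1) \<le> measure (occupation x T) {y}"
      using K by (simp add: add_divide_distrib)
  qed (use c_pos K in auto)
qed

end

section \<open>Laws and expected costs of chains with discrete state space\<close>

lemma tendsto_state_iff: "(f \<longlongrightarrow> (y::state)) F \<longleftrightarrow> eventually (\<lambda>t. f t = y) F"
proof
  assume "(f \<longlongrightarrow> y) F"
  moreover have "open ({fst y} \<times> {snd y})"
    by (intro open_Times Topological_Spaces.open_discrete)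
  then have "open {y}" by (cases y) simp
  ultimately have "eventually (\<lambda>t. f t \<in> {y}) F" by (intro topological_tendstoD) auto
  then show "eventually (\<lambda>t. f t = y) F" by simp
qed (rule tendsto_eventually)

text \<open>In a discrete space the jump times of a path with one-sided limits do not accumulate.\<close>

lemma countable_jump_times:
  fixes y :: "real \<Rightarrow> state"
  assumes right: "\<And>t. t \<ge> 0 \<Longrightarrow> (y \<longlongrightarrow> y t) (at_right t)"
    and left: "\<And>t. t > 0 \<Longrightarrow> \<exists>l. (y \<longlongrightarrow> l) (at_left t)"
  shows "countable {t. t > 0 \<and> Lim (at_left t) y \<noteq> y t}" (is "countable ?J")
proof -
  have "?J sparse_in {0<..}"
    unfolding sparse_in_def
  proof
    fix t :: real assume "t \<in> {0<..}"
    then have t: "t > 0" by simp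
    obtain l where "(y \<longlongrightarrow> l) (at_left t)" using left[OF t] by blast
    then have "eventually (\<lambda>s. y s = l) (at_left t)" by (simp add: tendsto_state_iff)
    then obtain a where a: "a < t" "\<And>s. a < s \<Longrightarrow> s < t \<Longrightarrow> y s = l"
      unfolding eventually_at_left_field by blast
    have "eventually (\<lambda>s. y s = y t) (at_right t)" using right[of t] t by (simp add: tendsto_state_iff)
    then obtain b where b: "b > t" "\<And>s. t < s \<Longrightarrow> s < b \<Longrightarrow> y s = y t"
      unfolding eventually_at_right_field by blast
    have no_jump: "s \<notin> ?J" if s: "s \<in> {max a 0<..<b}" "s \<noteq> t" for s
    proof -
      have "eventually (\<lambda>r. y r = y s) (at_left s)"
      proof (cases "s < t")
        case True
        then show ?thesis using a s unfolding eventually_at_left_field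
          by (intro exI[of _ "max a 0"]) auto
      next
        case False
        then show ?thesis using b s unfolding eventually_at_left_field
          by (intro exI[of _ t]) auto
      qed
      then have "(y \<longlongrightarrow> y s) (at_left s)" by (simp add: tendsto_state_iff)
      then have "Lim (at_left s) y = y s" by (intro tendsto_Lim) auto
      then show ?thesis by simp
    qed
    show "\<exists>B. t \<in> B \<and> open B \<and> (\<forall>s\<in>B. \<not> s islimpt ?J)"
    proof (intro exI[of _ "{max a 0<..<b}"] conjI ballI)
      fix s assume s: "s \<in> {max a 0<..<b}"
      show "\<not> s islimpt ?J"
      proof
        assume "s islimpt ?J"
        then obtain r where "r \<in> ?J" "r \<in> {max a 0<..<b} - ({t} - {s})" "r \<noteq> s"
          by (rule islimptE[where T = "{max a 0<..<b} - ({t} - {s})"]) (use s in \<open>auto intro!: open_Diff finite_imp_closed\<close>)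
        then show False using no_jump[of r] by blast
      qed
    qed (use t a b in auto)
  qed
  then have "countable ({0<..} \<inter> ?J)" by (intro sparse_imp_countable) auto
  then show ?thesis by (rule countable_subset[rotated]) auto
qed

text \<open>Joint measurability of a right-continuous process. It is the pointwise limit of the processes
  read at the next point strictly after \<open>t\<close> of the grid of mesh \<open>1 / Suc n\<close>. Times are cut off at \<open>0\<close>
  because nothing is known about negative ones.\<close>

lemma right_continuous_measurable:
  fixes Y :: "real \<Rightarrow> 'w \<Rightarrow> state"
  assumes Y: "\<And>t. t \<ge> 0 \<Longrightarrow> Y t \<in> measurable M (count_space UNIV)"
    and right: "\<And>\<omega> t. \<omega> \<in> space M \<Longrightarrow> t \<ge> 0 \<Longrightarrow> ((\<lambda>s. Y s \<omega>) \<longlongrightarrow> Y t \<omega>) (at_right t)"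
  shows "(\<lambda>(t, \<omega>). Y (max 0 t) \<omega>) \<in> measurable (borel \<Otimes>\<^sub>M M) (count_space UNIV)"
proof -
  define a where "a n t = real (Suc (nat \<lfloor>real (Suc n) * max 0 t\<rfloor>)) / real (Suc n)" for n :: nat and t :: real
  have a_gt: "a n t > max 0 t" for n t
  proof -
    define m where "m = real (Suc n) * max 0 t"
    have "m < real (Suc (nat \<lfloor>m\<rfloor>))" by linarith
    then have "m / real (Suc n) < a n t"
      unfolding a_def m_def by (intro divide_strict_right_mono) auto
    then show ?thesis by (simp add: m_def)
  qed
  have a_le: "a n t \<le> max 0 t + 1 / real (Suc n)" for n t
  proof -
    have "0 \<le> real (Suc n) * max 0 t" by simp
    then have "real (nat \<lfloor>real (Suc n) * max 0 t\<rfloor>) \<le> real (Suc n) * max 0 t" by linarith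
    then have "a n t \<le> (real (Suc n) * max 0 t + 1) / real (Suc n)"
      unfolding a_def by (intro divide_right_mono) auto
    then show ?thesis by (simp add: add_divide_distrib)
  qed
  have a_lim: "filterlim (\<lambda>n. a n t) (at_right (max 0 t)) sequentially" for t
  proof -
    have "(\<lambda>n. max 0 t + 1 / real (Suc n)) \<longlonglongrightarrow> max 0 t + 0"
      by (intro tendsto_intros LIMSEQ_Suc[OF lim_const_over_n])
    then have up: "(\<lambda>n. max 0 t + 1 / real (Suc n)) \<longlonglongrightarrow> max 0 t" by simp
    have "(\<lambda>n. a n t) \<longlonglongrightarrow> max 0 t"
      by (rule tendsto_sandwich[OF _ _ tendsto_const up])
        (use a_gt a_le in \<open>auto intro!: always_eventually less_imp_le\<close>)
    then show ?thesis using a_gt[of t]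
      by (auto simp: filterlim_at less_imp_neq[symmetric] intro!: always_eventually)
  qed
  have Z: "(\<lambda>x. Y (a n (fst x)) (snd x)) \<in> measurable (borel \<Otimes>\<^sub>M M) (count_space UNIV)" for n
    unfolding a_def
  proof (rule measurable_compose_countable[where f = "\<lambda>k x. Y (real (Suc k) / real (Suc n)) (snd x)"
        and g = "\<lambda>x. nat \<lfloor>real (Suc n) * max 0 (fst x)\<rfloor>"])
    show "(\<lambda>x. Y (real (Suc k) / real (Suc n)) (snd x)) \<in> measurable (borel \<Otimes>\<^sub>M M) (count_space UNIV)" for k
      by (rule measurable_compose[OF measurable_snd Y]) auto
    show "(\<lambda>x. nat \<lfloor>real (Suc n) * max 0 (fst x)\<rfloor>) \<in> measurable (borel \<Otimes>\<^sub>M M) (count_space UNIV)"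
      by measurable
  qed
  have ev: "eventually (\<lambda>n. Y (a n t) \<omega> = Y (max 0 t) \<omega>) sequentially" if "\<omega> \<in> space M" for t \<omega>
  proof -
    have "eventually (\<lambda>s. Y s \<omega> = Y (max 0 t) \<omega>) (at_right (max 0 t))"
      using right[OF that, of "max 0 t"] by (simp add: tendsto_state_iff)
    from eventually_compose_filterlim[OF this a_lim] show ?thesis .
  qed
  have iff: "Y (max 0 t) \<omega> = y \<longleftrightarrow> (\<exists>m. \<forall>n\<ge>m. Y (a n t) \<omega> = y)" if "\<omega> \<in> space M" for t \<omega> y
    using ev[OF that, of t] unfolding eventually_sequentially
    by (metis le_cases)
  show ?thesis
  proof (subst measurable_count_space_eq2_countable, intro conjI ballI funcsetI)
    fix y
    have [measurable]: "Measurable.pred (borel \<Otimes>\<^sub>M M) (\<lambda>x. Y (a n (fst x)) (snd x) = y)" for n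
      using Z[of n] by measurable
    have "(\<lambda>(t, \<omega>). Y (max 0 t) \<omega>) -` {y} \<inter> space (borel \<Otimes>\<^sub>M M) =
        {x \<in> space (borel \<Otimes>\<^sub>M M). \<exists>m. \<forall>n\<ge>m. Y (a n (fst x)) (snd x) = y}"
    proof (rule set_eqI)
      fix x :: "real \<times> 'w"
      obtain t \<omega> where x: "x = (t, \<omega>)" by (cases x)
      show "x \<in> (\<lambda>(t, \<omega>). Y (max 0 t) \<omega>) -` {y} \<inter> space (borel \<Otimes>\<^sub>M M) \<longleftrightarrow>
          x \<in> {x \<in> space (borel \<Otimes>\<^sub>M M). \<exists>m. \<forall>n\<ge>m. Y (a n (fst x)) (snd x) = y}"
        using iff[of \<omega> t y] unfolding x by (cases "\<omega> \<in> space M") (auto simp: space_pair_measure)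
    qed
    also have "\<dots> \<in> sets (borel \<Otimes>\<^sub>M M)" by measurable
    finally show "(\<lambda>(t, \<omega>). Y (max 0 t) \<omega>) -` {y} \<inter> space (borel \<Otimes>\<^sub>M M) \<in> sets (borel \<Otimes>\<^sub>M M)" .
  qed auto
qed

lemma markov_chain_law:
  assumes chain: "markov_chain M Y Q x"
    and PM: "markov_with M Y P" and P0: "transition_function P" and t: "t \<ge> 0"
  shows "distr M (count_space UNIV) (Y t) = measure_pmf (P t x)"
proof -
  interpret prob_space M using chain by (simp add: markov_chain_def)
  have Y[measurable]: "Y s \<in> measurable M (count_space UNIV)" if "s \<ge> 0" for s
    using chain that by (simp add: markov_chain_def)
  have Y0: "AE \<omega> in M. Y 0 \<omega> = x" using chain by (simp add: markov_chain_def)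
  have pred[measurable]: "Measurable.pred M (\<lambda>\<omega>. Y s \<omega> = y)" if "s \<ge> 0" for s y
    using Y[OF that] by measurable
  have p0: "prob {\<omega> \<in> space M. Y 0 \<omega> = x} = 1" using Y0 by (subst prob_Collect_eq_1) auto
  have *: "prob {\<omega> \<in> space M. Y t \<omega> = y} = pmf (P t x) y" for y
  proof (cases "t = 0")
    case True
    have "prob {\<omega> \<in> space M. Y 0 \<omega> = y} = of_bool (y = x)"
    proof (cases "y = x")
      case False
      have "AE \<omega> in M. Y 0 \<omega> \<noteq> y" using Y0 by eventually_elim (use False in auto)
      moreover have "{\<omega> \<in> space M. Y 0 \<omega> = y} \<in> events" using pred[of 0 y] by (simp add: pred_def)
      ultimately show ?thesis using False by (simp add: prob_eq_0)
    qed (simp add: p0)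
    moreover have "P 0 x = return_pmf x" using P0 unfolding transition_function_def by blast
    ultimately show ?thesis using True by (simp add: pmf_return)
  next
    case False
    define s where "s l = (if l = 0 then 0 else t)" for l :: nat
    define v where "v l = (if l = 0 then x else y)" for l :: nat
    have "prob {\<omega> \<in> space M. \<forall>l\<le>1. Y (s l) \<omega> = v l} =
        prob {\<omega> \<in> space M. Y (s 0) \<omega> = v 0} * (\<Prod>l<1. pmf (P (s (Suc l) - s l) (v l)) (v (Suc l)))"
      using PM False t unfolding markov_with_def by (auto simp: s_def)
    also have "\<dots> = pmf (P t x) y" by (simp add: s_def v_def p0)
    also have "{\<omega> \<in> space M. \<forall>l\<le>1. Y (s l) \<omega> = v l} = {\<omega> \<in> space M. Y 0 \<omega> = x \<and> Y t \<omega> = y}"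
      by (auto simp: s_def v_def le_Suc_eq)
    also have "prob \<dots> = prob {\<omega> \<in> space M. Y t \<omega> = y}"
      by (rule finite_measure_eq_AE) (use Y0 t in auto)
    finally show ?thesis .
  qed
  show ?thesis
  proof (rule measure_eqI_countable[where A = UNIV])
    show "emeasure (distr M (count_space UNIV) (Y t)) {y} = emeasure (measure_pmf (P t x)) {y}" for y
      using *[of y] t
      by (simp add: emeasure_distr vimage_def Int_def conj_commute emeasure_eq_measure emeasure_pmf_single)
  qed auto
qed

text \<open>The left limit \<open>Y(t-)\<close> differs from \<open>Y(t)\<close> only at the countably many jump times, so it may be
  replaced by \<open>Y(t)\<close> under the time integral.\<close>

lemma expected_cost_eq:
  assumes chain: "markov_chain M Y Q x"
    and law: "\<And>t. t \<ge> 0 \<Longrightarrow> distr M (count_space UNIV) (Y t) = measure_pmf (P t x)"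
  shows "(\<integral>\<^sup>+\<omega>. (\<integral>\<^sup>+t\<in>{0..T}. f (Y t \<omega>) (Lim (at_left t) (\<lambda>s. Y s \<omega>)) \<partial>lborel) \<partial>M) =
    (\<integral>\<^sup>+t\<in>{0..T}. (\<integral>\<^sup>+y. f y y \<partial>measure_pmf (P t x)) \<partial>lborel)"
proof -
  interpret prob_space M using chain by (simp add: markov_chain_def)
  interpret pair_sigma_finite M lborel ..
  have Y: "Y s \<in> measurable M (count_space UNIV)" if "s \<ge> 0" for s
    using chain that by (simp add: markov_chain_def)
  have right: "((\<lambda>s. Y s \<omega>) \<longlongrightarrow> Y t \<omega>) (at_right t)" if "\<omega> \<in> space M" "t \<ge> 0" for \<omega> t
    using chain that by (simp add: markov_chain_def)
  have left: "\<exists>l. ((\<lambda>s. Y s \<omega>) \<longlongrightarrow> l) (at_left t)" if "\<omega> \<in> space M" "t > 0" for \<omega> t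
    using chain that by (simp add: markov_chain_def)
  have "(\<lambda>(t, \<omega>). Y (max 0 t) \<omega>) \<in> measurable (lborel \<Otimes>\<^sub>M M) (count_space UNIV)"
    using right_continuous_measurable[OF Y right] by (simp cong: measurable_cong_sets)
  from measurable_compose[OF measurable_pair_swap' this]
  have [measurable]: "(\<lambda>(\<omega>, t). Y (max 0 t) \<omega>) \<in> measurable (M \<Otimes>\<^sub>M lborel) (count_space UNIV)"
    by (simp add: case_prod_unfold)
  have [measurable]: "(\<lambda>y. f y y) \<in> borel_measurable (count_space UNIV)" by simp
  have meas: "(\<lambda>(\<omega>, t). f (Y (max 0 t) \<omega>) (Y (max 0 t) \<omega>) * indicator {0..T} t)
      \<in> borel_measurable (M \<Otimes>\<^sub>M lborel)"
  proof -
    have [measurable]: "(\<lambda>x. f (Y (max 0 (snd x)) (fst x)) (Y (max 0 (snd x)) (fst x)))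
        \<in> borel_measurable (M \<Otimes>\<^sub>M lborel)"
      by (rule measurable_compose[where g = "\<lambda>y. f y y" and N = "count_space UNIV"])
        (simp_all add: case_prod_unfold[symmetric])
    show ?thesis unfolding case_prod_unfold by measurable
  qed
  have "(\<integral>\<^sup>+\<omega>. (\<integral>\<^sup>+t\<in>{0..T}. f (Y t \<omega>) (Lim (at_left t) (\<lambda>s. Y s \<omega>)) \<partial>lborel) \<partial>M) =
      (\<integral>\<^sup>+\<omega>. (\<integral>\<^sup>+t. f (Y (max 0 t) \<omega>) (Y (max 0 t) \<omega>) * indicator {0..T} t \<partial>lborel) \<partial>M)"
  proof (rule nn_integral_cong, rule nn_integral_cong_AE)
    fix \<omega> assume \<omega>: "\<omega> \<in> space M"
    have "countable ({t. t > 0 \<and> Lim (at_left t) (\<lambda>s. Y s \<omega>) \<noteq> Y t \<omega>} \<union> {0})"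
      using countable_jump_times[of "\<lambda>s. Y s \<omega>"] right[OF \<omega>] left[OF \<omega>] by simp
    then have "AE t in lborel. t \<notin> {t. t > 0 \<and> Lim (at_left t) (\<lambda>s. Y s \<omega>) \<noteq> Y t \<omega>} \<union> {0}"
      by (intro AE_not_in countable_imp_null_set_lborel)
    then show "AE t in lborel. f (Y t \<omega>) (Lim (at_left t) (\<lambda>s. Y s \<omega>)) * indicator {0..T} t =
        f (Y (max 0 t) \<omega>) (Y (max 0 t) \<omega>) * indicator {0..T} t"
      by eventually_elim (auto simp: indicator_def max_def)
  qed
  also have "\<dots> = (\<integral>\<^sup>+t. (\<integral>\<^sup>+\<omega>. f (Y (max 0 t) \<omega>) (Y (max 0 t) \<omega>) * indicator {0..T} t \<partial>M) \<partial>lborel)"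
    by (rule Fubini'[OF meas, symmetric])
  also have "\<dots> = (\<integral>\<^sup>+t\<in>{0..T}. (\<integral>\<^sup>+y. f y y \<partial>measure_pmf (P t x)) \<partial>lborel)"
  proof (intro nn_integral_cong)
    fix t :: real
    show "(\<integral>\<^sup>+\<omega>. f (Y (max 0 t) \<omega>) (Y (max 0 t) \<omega>) * indicator {0..T} t \<partial>M) =
        (\<integral>\<^sup>+y. f y y \<partial>measure_pmf (P t x)) * indicator {0..T} t"
    proof (cases "t \<in> {0..T}")
      case True
      then have "(\<integral>\<^sup>+y. f y y \<partial>distr M (count_space UNIV) (Y t)) = (\<integral>\<^sup>+\<omega>. f (Y t \<omega>) (Y t \<omega>) \<partial>M)"
        by (intro nn_integral_distr Y) auto
      then show ?thesis using True law[of t] by (simp add: max_def)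
    qed simp
  qed
  finally show ?thesis .
qed

section \<open>The optimality equation\<close>

text \<open>Banach's fixed point theorem for a supremum norm weighted by \<open>V\<close>, on functions on an arbitrary
  set.\<close>

lemma weighted_fixpoint:
  fixes T :: "('s \<Rightarrow> real) \<Rightarrow> 's \<Rightarrow> real"
  assumes \<rho>: "0 \<le> \<rho>" "\<rho> < 1"
    and contr: "\<And>u v C. (\<And>x. \<bar>u x - v x\<bar> \<le> C * V x) \<Longrightarrow> (\<And>x. \<bar>T u x - T v x\<bar> \<le> \<rho> * C * V x)"
    and T0: "\<And>x. \<bar>T (\<lambda>_. 0) x\<bar> \<le> D * V x"
  obtains u where "T u = u" "\<And>x. \<bar>u x\<bar> \<le> D / (1 - \<rho>) * V x"
proof -
  define s where "s n = (T ^^ n) (\<lambda>_. 0)" for n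
  have step: "\<bar>s (Suc n) x - s n x\<bar> \<le> \<rho> ^ n * D * V x" for n x
  proof (induction n arbitrary: x)
    case 0
    then show ?case using T0 by (simp add: s_def)
  next
    case (Suc n)
    from contr[of "s (Suc n)" "s n" "\<rho> ^ n * D", OF Suc]
    show ?case by (simp add: s_def mult.assoc)
  qed
  have geo: "summable (\<lambda>n. \<rho> ^ n * D * V x)" for x
    using \<rho> by (intro summable_mult2 summable_geometric) auto
  have summ: "summable (\<lambda>n. s (Suc (n + m)) x - s (n + m) x)" for x m
    by (rule summable_comparison_test'[OF summable_ignore_initial_segment[OF geo[of x], of m]])
      (use step in auto)
  define u where "u x = (\<Sum>n. s (Suc n) x - s n x)" for x
  have dist: "\<bar>u x - s m x\<bar> \<le> D / (1 - \<rho>) * \<rho> ^ m * V x" for x m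
  proof -
    have tele: "(\<Sum>n<m. s (Suc n) x - s n x) = s m x"
      by (subst sum_lessThan_telescope) (simp add: s_def)
    have "u x = (\<Sum>n. s (Suc (n + m)) x - s (n + m) x) + (\<Sum>n<m. s (Suc n) x - s n x)"
      unfolding u_def using summ[of 0 x] by (intro suminf_split_initial_segment) simp
    then have "\<bar>u x - s m x\<bar> = \<bar>\<Sum>n. s (Suc (n + m)) x - s (n + m) x\<bar>" using tele by simp
    also have "\<dots> \<le> (\<Sum>n. \<rho> ^ (n + m) * D * V x)"
      using norm_suminf_le[of "\<lambda>n. s (Suc (n + m)) x - s (n + m) x" "\<lambda>n. \<rho> ^ (n + m) * D * V x"]
        step summable_ignore_initial_segment[OF geo[of x], of m] by simp
    also have "\<dots> = (\<Sum>n. \<rho> ^ n * (\<rho> ^ m * D * V x))" by (simp add: power_add mult_ac)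
    also have "\<dots> = (\<Sum>n. \<rho> ^ n) * (\<rho> ^ m * D * V x)"
      using \<rho> by (intro suminf_mult2[symmetric] summable_geometric) auto
    also have "\<dots> = D / (1 - \<rho>) * \<rho> ^ m * V x" using \<rho> by (simp add: suminf_geometric)
    finally show ?thesis .
  qed
  have pow: "(\<lambda>n. K * \<rho> ^ n * v) \<longlonglongrightarrow> 0" for K v :: real
    using \<rho> by (intro tendsto_mult_left_zero tendsto_mult_right_zero LIMSEQ_realpow_zero)
  have "T u x = u x" for x
  proof (rule LIMSEQ_unique)
    show "(\<lambda>n. s (Suc n) x) \<longlonglongrightarrow> T u x"
    proof (rule LIM_zero_cancel, rule Lim_null_comparison)
      show "(\<lambda>n. (\<rho> * D / (1 - \<rho>)) * \<rho> ^ n * V x) \<longlonglongrightarrow> 0" by (rule pow)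
      show "\<forall>\<^sub>F n in sequentially. norm (s (Suc n) x - T u x) \<le> (\<rho> * D / (1 - \<rho>)) * \<rho> ^ n * V x"
        using contr[OF dist] by (auto simp: s_def abs_minus_commute mult_ac intro!: always_eventually)
    qed
    show "(\<lambda>n. s (Suc n) x) \<longlonglongrightarrow> u x"
    proof (rule LIM_zero_cancel, rule Lim_null_comparison)
      show "(\<lambda>n. (D / (1 - \<rho>) * \<rho>) * \<rho> ^ n * V x) \<longlonglongrightarrow> 0" by (rule pow)
      show "\<forall>\<^sub>F n in sequentially. norm (s (Suc n) x - u x) \<le> (D / (1 - \<rho>) * \<rho>) * \<rho> ^ n * V x"
        using dist[of x "Suc _"] by (auto simp: abs_minus_commute mult_ac intro!: always_eventually)
    qed
  qed
  moreover have "\<bar>u x\<bar> \<le> D / (1 - \<rho>) * V x" for x using dist[of x 0] by (simp add: s_def)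
  ultimately show ?thesis by (intro that[of u]) auto
qed

text \<open>A control model whose rates and costs are affine in an action from \<open>{\<gamma>..R}\<close>, with finitely
  supported rows, bounded rates and a drift condition towards \<open>z\<close> that is uniform in the action.\<close>

locale affine_control =
  fixes q :: "real \<Rightarrow> 's \<Rightarrow> 's \<Rightarrow> real" and r :: "'s \<Rightarrow> real \<Rightarrow> real"
    and \<gamma> R :: real and N :: "'s \<Rightarrow> 's set" and \<Lambda> :: real
    and W :: "'s \<Rightarrow> real" and z :: 's and c b M :: real
  assumes action_le: "\<gamma> \<le> R"
    and finite_N: "finite (N x)" and self_in_N: "x \<in> N x"
    and q_outside: "y \<notin> N x \<Longrightarrow> q a x y = 0"
    and q_conservative: "(\<Sum>y\<in>N x. q a x y) = 0"
    and q_nonneg: "a \<in> {\<gamma>..R} \<Longrightarrow> x \<noteq> y \<Longrightarrow> 0 \<le> q a x y"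
    and exit_rate_le: "a \<in> {\<gamma>..R} \<Longrightarrow> - q a x x \<le> \<Lambda>"
    and \<Lambda>_pos: "0 < \<Lambda>"
    and affine: "\<exists>\<alpha> \<kappa>. \<forall>a. r x a + (\<Sum>y\<in>N x. q a x y * u y) = \<alpha> + a * \<kappa>"
    and W_ge_1: "1 \<le> W x"
    and c_pos: "0 < c" and b_nonneg: "0 \<le> b"
    and drift: "a \<in> {\<gamma>..R} \<Longrightarrow> (\<Sum>y\<in>N x. q a x y * W y) \<le> - c * W x + b * of_bool (x = z)"
    and cost_nonneg: "a \<in> {\<gamma>..R} \<Longrightarrow> 0 \<le> r x a"
    and cost_le: "a \<in> {\<gamma>..R} \<Longrightarrow> r x a \<le> M * W x"
begin

text \<open>The generator under the action \<open>a\<close>.\<close>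

definition G :: "real \<Rightarrow> ('s \<Rightarrow> real) \<Rightarrow> 's \<Rightarrow> real" where
  "G a u x = (\<Sum>y\<in>N x. q a x y * u y)"

lemma infsum_G: "(\<Sum>\<^sub>\<infinity>y. u y * q a x y) = G a u x"
proof -
  have "(\<Sum>\<^sub>\<infinity>y. u y * q a x y) = (\<Sum>\<^sub>\<infinity>y\<in>N x. q a x y * u y)"
    by (rule infsum_cong_neutral) (auto simp: q_outside)
  then show ?thesis using finite_N by (simp add: G_def)
qed

lemma G_diff: "G a (\<lambda>y. u y - v y) x = G a u x - G a v x"
  by (simp add: G_def algebra_simps sum_subtractf)

lemma G_const: "G a (\<lambda>y. k) x = 0"
  using q_conservative[of a x] by (simp add: G_def flip: sum_distrib_right)

text \<open>An affine function on an interval is minimal at an endpoint; the two extreme actions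
  suffice.\<close>

lemma objective_ge_endpoint:
  assumes "a \<in> {\<gamma>..R}"
  shows "min (r x \<gamma> + G \<gamma> u x) (r x R + G R u x) \<le> r x a + G a u x"
proof -
  obtain \<alpha> \<kappa> where *: "\<And>a. r x a + G a u x = \<alpha> + a * \<kappa>"
    using affine[of x u] unfolding G_def by blast
  show ?thesis
  proof (cases "\<kappa> \<ge> 0")
    case True
    then have "\<gamma> * \<kappa> \<le> a * \<kappa>" using assms by (intro mult_right_mono) auto
    then show ?thesis unfolding * by linarith
  next
    case False
    then have "R * \<kappa> \<le> a * \<kappa>" using assms by (intro mult_right_mono_neg) auto
    then show ?thesis unfolding * by linarith
  qed
qed

lemma INF_objective:
  "(INF a\<in>{\<gamma>..R}. r x a + G a u x) = min (r x \<gamma> + G \<gamma> u x) (r x R + G R u x)"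
proof (rule cInf_eq_minimum)
  show "min (r x \<gamma> + G \<gamma> u x) (r x R + G R u x) \<in> (\<lambda>a. r x a + G a u x) ` {\<gamma>..R}"
    using action_le by (auto simp: min_def)
qed (use objective_ge_endpoint in auto)

text \<open>The average-cost optimality equation, with the infimum over actions evaluated.\<close>

definition acoe :: "real \<Rightarrow> ('s \<Rightarrow> real) \<Rightarrow> bool" where
  "acoe g u \<longleftrightarrow> (\<forall>x. g = min (r x \<gamma> + G \<gamma> u x) (r x R + G R u x))"

lemma acoe_le: "acoe g u \<Longrightarrow> a \<in> {\<gamma>..R} \<Longrightarrow> g \<le> r x a + G a u x"
  using objective_ge_endpoint unfolding acoe_def by metis

lemma acoe_attained:
  assumes "acoe g u"
  obtains a where "a \<in> {\<gamma>..R}" "g = r x a + G a u x"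
proof -
  have "g = r x \<gamma> + G \<gamma> u x \<or> g = r x R + G R u x"
    using assms unfolding acoe_def by (metis min_def)
  then show ?thesis using that action_le by auto
qed

text \<open>Uniformization: the transition operator of the discrete-time chain that is observed at the jumps
  of a Poisson process of rate \<open>\<Lambda>\<close>.\<close>

definition K :: "real \<Rightarrow> ('s \<Rightarrow> real) \<Rightarrow> 's \<Rightarrow> real" where
  "K a u x = u x + G a u x / \<Lambda>"

text \<open>\<open>K a (killed u)\<close> is the transition operator of the chain killed on entering \<open>z\<close>.\<close>

definition killed :: "('s \<Rightarrow> real) \<Rightarrow> 's \<Rightarrow> real" where
  "killed u = u(z := 0)"

lemma K_sum: "K a u x = (\<Sum>y\<in>N x. (of_bool (y = x) + q a x y / \<Lambda>) * u y)"
proof -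
  have "(\<Sum>y\<in>N x. of_bool (y = x) * u y) = u x"
    using finite_N self_in_N by (simp add: of_bool_def if_distrib[of "\<lambda>t. t * _"] cong: if_cong)
  then show ?thesis
    by (simp add: K_def G_def distrib_right sum.distrib sum_divide_distrib)
qed

lemma K_mono:
  assumes a: "a \<in> {\<gamma>..R}" and uv: "\<And>y. u y \<le> v y"
  shows "K a u x \<le> K a v x"
  unfolding K_sum
proof (intro sum_mono mult_right_mono mult_left_mono uv)
  fix y
  have "- \<Lambda> / \<Lambda> \<le> q a x x / \<Lambda>" using exit_rate_le[OF a, of x] \<Lambda>_pos by (intro divide_right_mono) auto
  then show "0 \<le> of_bool (y = x) + q a x y / \<Lambda>"
    using q_nonneg[OF a, of x y] \<Lambda>_pos by (cases "y = x") auto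
qed

lemma K_diff: "K a (\<lambda>y. u y - v y) x = K a u x - K a v x"
  by (simp add: K_def G_diff diff_divide_distrib)

lemma K_scale: "K a (\<lambda>y. k * u y) x = k * K a u x"
  by (simp add: K_def G_def sum_distrib_left algebra_simps)

lemma killed_diff: "killed (\<lambda>y. u y - v y) = (\<lambda>y. killed u y - killed v y)"
  and killed_scale: "killed (\<lambda>y. k * u y) = (\<lambda>y. k * killed u y)"
  by (auto simp: killed_def)

lemma killed_mono: "(\<And>y. u y \<le> v y) \<Longrightarrow> killed u y \<le> killed v y"
  by (simp add: killed_def)

text \<open>The killed operator never looks at the weight of \<open>z\<close>, so this weight may be raised from \<open>W z\<close> to
  \<open>B\<close>, which is large enough to absorb the constant \<open>b\<close> of the drift condition: with respect to
  the weight \<open>V\<close> the killed chain contracts by the factor \<open>\<rho>\<close> from every starting state. The bound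
  \<open>1 / 2 \<le> \<rho>\<close> matches the factor \<open>2\<close> in \<open>B\<close>.\<close>

definition \<rho> :: real where "\<rho> = max (1 / 2) (1 - c / \<Lambda>)"
definition B :: real where "B = 2 * (W z + b / \<Lambda>)"
definition V :: "'s \<Rightarrow> real" where "V = W(z := B)"

lemma \<rho>_bounds: "0 \<le> \<rho>" "\<rho> < 1"
  using c_pos \<Lambda>_pos by (auto simp: \<rho>_def)

lemma B_ge: "2 \<le> B"
proof -
  have "0 \<le> b / \<Lambda>" using b_nonneg \<Lambda>_pos by simp
  then show ?thesis using W_ge_1[of z] by (simp add: B_def)
qed

lemma W_le_V: "W x \<le> V x"
proof -
  have "0 \<le> b / \<Lambda>" using b_nonneg \<Lambda>_pos by simp
  then show ?thesis using W_ge_1[of z] by (simp add: V_def B_def)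
qed

lemma V_ge_1: "1 \<le> V x"
  using W_ge_1 W_le_V order_trans by blast

lemma V_le_W: "V x \<le> B * W x"
proof (cases "x = z")
  case True
  have "B * 1 \<le> B * W z" using W_ge_1 B_ge by (intro mult_left_mono) auto
  then show ?thesis using True by (simp add: V_def)
next
  case False
  have "1 * W x \<le> B * W x" using W_ge_1[of x] B_ge by (intro mult_right_mono) auto
  then show ?thesis using False by (simp add: V_def)
qed

lemma K_killed_V:
  assumes a: "a \<in> {\<gamma>..R}"
  shows "K a (killed V) x \<le> \<rho> * V x"
proof -
  have "K a (killed V) x \<le> K a W x"
    by (rule K_mono[OF a]) (use W_ge_1 in \<open>auto simp: killed_def V_def intro: order_trans[OF zero_le_one]\<close>)
  also have "\<dots> \<le> W x + (- c * W x + b * of_bool (x = z)) / \<Lambda>"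
    unfolding K_def G_def using drift[OF a, of x] \<Lambda>_pos
    by (intro add_left_mono divide_right_mono) auto
  also have "\<dots> = (1 - c / \<Lambda>) * W x + b / \<Lambda> * of_bool (x = z)"
    by (simp add: algebra_simps add_divide_distrib diff_divide_distrib)
  also have "\<dots> \<le> \<rho> * V x"
  proof (cases "x = z")
    case True
    have "(1 - c / \<Lambda>) * W z \<le> 1 * W z"
      using c_pos \<Lambda>_pos W_ge_1[of z] by (intro mult_right_mono) auto
    moreover have "1 / 2 * B \<le> \<rho> * B" using B_ge by (intro mult_right_mono) (auto simp: \<rho>_def)
    moreover have "1 / 2 * B = W z + b / \<Lambda>" by (simp add: B_def)
    ultimately have "(1 - c / \<Lambda>) * W z + b / \<Lambda> \<le> \<rho> * B" by linarith
    then show ?thesis using True by (simp add: V_def)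
  next
    case False
    have "(1 - c / \<Lambda>) * W x \<le> \<rho> * W x"
      using W_ge_1[of x] by (intro mult_right_mono) (auto simp: \<rho>_def)
    then show ?thesis using False by (simp add: V_def)
  qed
  finally show ?thesis .
qed

lemma killed_maximum_principle:
  assumes bound: "\<And>x. w x \<le> C * V x"
    and sub: "\<And>x. \<exists>a\<in>{\<gamma>..R}. w x \<le> K a (killed w) x"
  shows "w x \<le> 0"
proof -
  have iter: "w x \<le> \<bar>C\<bar> * \<rho> ^ n * V x" for n x
  proof (induction n arbitrary: x)
    case 0
    have "C * V x \<le> \<bar>C\<bar> * V x" using V_ge_1[of x] by (intro mult_right_mono) auto
    then show ?case using bound[of x] by simp
  next
    case (Suc n)
    obtain a where a: "a \<in> {\<gamma>..R}" "w x \<le> K a (killed w) x" using sub by blast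
    have "K a (killed w) x \<le> K a (killed (\<lambda>y. \<bar>C\<bar> * \<rho> ^ n * V y)) x"
      by (intro K_mono[OF a(1)] killed_mono Suc)
    also have "\<dots> = \<bar>C\<bar> * \<rho> ^ n * K a (killed V) x" by (simp only: killed_scale K_scale)
    also have "\<dots> \<le> \<bar>C\<bar> * \<rho> ^ n * (\<rho> * V x)"
      using \<rho>_bounds by (intro mult_left_mono K_killed_V[OF a(1)]) auto
    finally show ?case using a(2) by (simp add: mult_ac)
  qed
  have "(\<lambda>n. \<bar>C\<bar> * \<rho> ^ n * V x) \<longlonglongrightarrow> 0"
    using \<rho>_bounds by (intro tendsto_mult_left_zero tendsto_mult_right_zero LIMSEQ_realpow_zero) auto
  then show ?thesis by (rule LIMSEQ_le_const) (use iter in blast)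
qed

text \<open>After subtraction of its value at \<open>z\<close>, the difference of two solutions is subharmonic for a suitable
  choice of actions and vanishes at \<open>z\<close>, so it is unaffected by killing.\<close>

lemma acoe_unique:
  assumes u: "acoe g u" "\<And>x. \<bar>u x\<bar> \<le> C * W x" and v: "acoe g v" "\<And>x. \<bar>v x\<bar> \<le> D * W x"
  shows "v x = u x + (v z - u z)"
proof -
  have le: "v x - u x \<le> v z - u z"
    if u: "acoe g u" "\<And>x. \<bar>u x\<bar> \<le> C * W x" and v: "acoe g v" "\<And>x. \<bar>v x\<bar> \<le> D * W x"
    for u v C D x
  proof -
    define w where "w y = v y - u y - (v z - u z)" for y
    have killed_w: "killed w = w" by (auto simp: killed_def w_def)
    have "w x \<le> 0"
    proof (rule killed_maximum_principle[where C = "C + D + \<bar>v z - u z\<bar>"])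
      fix y
      have "\<bar>v z - u z\<bar> \<le> \<bar>v z - u z\<bar> * W y"
        using mult_left_mono[OF W_ge_1[of y], of "\<bar>v z - u z\<bar>"] by simp
      then have 1: "w y \<le> (C + D + \<bar>v z - u z\<bar>) * W y"
        using u(2)[of y] v(2)[of y] unfolding w_def distrib_right by linarith
      have "0 \<le> C * W z" "0 \<le> D * W z" using u(2)[of z] v(2)[of z] by linarith+
      then have "0 \<le> C" "0 \<le> D" using W_ge_1[of z] by (auto simp: zero_le_mult_iff)
      then have "(C + D + \<bar>v z - u z\<bar>) * W y \<le> (C + D + \<bar>v z - u z\<bar>) * V y"
        by (intro mult_left_mono W_le_V) auto
      with 1 show "w y \<le> (C + D + \<bar>v z - u z\<bar>) * V y" by linarith
      obtain a where a: "a \<in> {\<gamma>..R}" "g = r y a + G a u y" using acoe_attained[OF u(1)] .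
      have "g \<le> r y a + G a v y" by (rule acoe_le[OF v(1) a(1)])
      then have "0 \<le> G a w y" using a(2) unfolding w_def G_diff G_const by simp
      then have "w y \<le> K a (killed w) y" using \<Lambda>_pos by (simp add: K_def killed_w)
      then show "\<exists>a\<in>{\<gamma>..R}. w y \<le> K a (killed w) y" using a(1) by blast
    qed
    then show ?thesis by (simp add: w_def)
  qed
  show ?thesis using le[OF u v, of x] le[OF v u, of x] by linarith
qed

text \<open>The Bellman operator of the following problem: run the uniformized chain until it enters \<open>z\<close> and pay
  \<open>r - g\<close> per unit of time. Only the two extreme actions are considered.\<close>

definition bellman :: "real \<Rightarrow> ('s \<Rightarrow> real) \<Rightarrow> 's \<Rightarrow> real" where
  "bellman g u x = min ((r x \<gamma> - g) / \<Lambda> + K \<gamma> (killed u) x) ((r x R - g) / \<Lambda> + K R (killed u) x)"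

lemma K_killed_abs_le:
  assumes a: "a \<in> {\<gamma>..R}" and uv: "\<And>y. \<bar>u y - v y\<bar> \<le> C * V y"
  shows "\<bar>K a (killed u) x - K a (killed v) x\<bar> \<le> \<rho> * C * V x"
proof -
  have le: "K a (killed u) x - K a (killed v) x \<le> \<rho> * C * V x"
    if "\<And>y. u y - v y \<le> C * V y" "0 \<le> C" for u v
  proof -
    have "K a (killed u) x - K a (killed v) x = K a (killed (\<lambda>y. u y - v y)) x"
      by (simp only: killed_diff K_diff)
    also have "\<dots> \<le> K a (killed (\<lambda>y. C * V y)) x" by (intro K_mono[OF a] killed_mono that)
    also have "\<dots> = C * K a (killed V) x" by (simp only: killed_scale K_scale)
    also have "\<dots> \<le> C * (\<rho> * V x)" by (intro mult_left_mono K_killed_V[OF a] that)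
    finally show ?thesis by (simp add: mult_ac)
  qed
  have "0 \<le> C * V x" using uv[of x] by linarith
  then have C: "0 \<le> C" using V_ge_1[of x] by (auto simp: zero_le_mult_iff)
  have 1: "u y - v y \<le> C * V y" "v y - u y \<le> C * V y" for y using uv[of y] by linarith+
  show ?thesis using le[OF 1(1) C] le[OF 1(2) C] by linarith
qed

lemma bellman_contraction:
  assumes "\<And>y. \<bar>u y - v y\<bar> \<le> C * V y"
  shows "\<bar>bellman g u x - bellman g v x\<bar> \<le> \<rho> * C * V x"
  using K_killed_abs_le[of \<gamma> u v C x, OF _ assms] K_killed_abs_le[of R u v C x, OF _ assms] action_le
  unfolding bellman_def by (auto simp: min_def abs_if split: if_splits)

lemma bellman_0_bound: "\<bar>bellman g (\<lambda>_. 0) x\<bar> \<le> (\<bar>M\<bar> + \<bar>g\<bar>) / \<Lambda> * V x"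
proof -
  have K0: "K a (killed (\<lambda>_. 0)) x = 0" for a by (simp add: killed_def K_def G_def)
  have bd: "\<bar>(r x a - g) / \<Lambda>\<bar> \<le> (\<bar>M\<bar> + \<bar>g\<bar>) / \<Lambda> * V x" if a: "a \<in> {\<gamma>..R}" for a
  proof -
    have "M * W x \<le> \<bar>M\<bar> * V x" using W_le_V[of x] W_ge_1[of x] by (intro mult_mono) auto
    moreover have "\<bar>g\<bar> \<le> \<bar>g\<bar> * V x" using mult_left_mono[OF V_ge_1[of x], of "\<bar>g\<bar>"] by simp
    ultimately have "\<bar>r x a - g\<bar> \<le> (\<bar>M\<bar> + \<bar>g\<bar>) * V x"
      using cost_nonneg[OF a, of x] cost_le[OF a, of x] unfolding distrib_right by linarith
    then have "\<bar>r x a - g\<bar> / \<Lambda> \<le> (\<bar>M\<bar> + \<bar>g\<bar>) * V x / \<Lambda>"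
      using \<Lambda>_pos by (intro divide_right_mono) auto
    then show ?thesis using \<Lambda>_pos by simp
  qed
  have "\<gamma> \<in> {\<gamma>..R}" "R \<in> {\<gamma>..R}" using action_le by auto
  from bd[OF this(1)] bd[OF this(2)] show ?thesis
    unfolding bellman_def K0 by (simp add: min_def)
qed

lemma ex_fixpoint: "\<exists>u. bellman g u = u \<and> (\<exists>C. \<forall>x. \<bar>u x\<bar> \<le> C * V x)"
proof -
  obtain u where "bellman g u = u" "\<And>x. \<bar>u x\<bar> \<le> (\<bar>M\<bar> + \<bar>g\<bar>) / \<Lambda> / (1 - \<rho>) * V x"
    using weighted_fixpoint[of \<rho> V "bellman g" "(\<bar>M\<bar> + \<bar>g\<bar>) / \<Lambda>", OF \<rho>_bounds bellman_contraction bellman_0_bound] by blast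
  then show ?thesis by blast
qed

text \<open>The value function of that problem. (It is the unique fixed point of weighted growth, but only the
  existence is needed for the choice.)\<close>

definition U :: "real \<Rightarrow> 's \<Rightarrow> real" where
  "U g = (SOME u. bellman g u = u \<and> (\<exists>C. \<forall>x. \<bar>u x\<bar> \<le> C * V x))"

lemma bellman_U: "bellman g (U g) x = U g x" and U_bounded: "\<exists>C. \<forall>x. \<bar>U g x\<bar> \<le> C * V x"
  using someI_ex[OF ex_fixpoint[of g]] unfolding U_def by auto

lemma U_le:
  assumes "a \<in> {\<gamma>, R}"
  shows "U g x \<le> (r x a - g) / \<Lambda> + K a (killed (U g)) x"
  using assms bellman_U[of g x] unfolding bellman_def by auto

lemma U_attained:
  obtains a where "a \<in> {\<gamma>, R}" "U g x = (r x a - g) / \<Lambda> + K a (killed (U g)) x"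
  using that bellman_U[of g x] unfolding bellman_def min_def by (metis insertI1 insertI2 singletonI)

lemma U_diff_step:
  "\<exists>a\<in>{\<gamma>..R}. U g x - U h x \<le> (h - g) / \<Lambda> + K a (killed (\<lambda>y. U g y - U h y)) x"
proof -
  obtain a where a: "a \<in> {\<gamma>, R}" "U h x = (r x a - h) / \<Lambda> + K a (killed (U h)) x"
    by (rule U_attained)
  have "U g x - U h x \<le> (h - g) / \<Lambda> + (K a (killed (U g)) x - K a (killed (U h)) x)"
    using U_le[OF a(1), of g x] a(2) by (simp add: diff_divide_distrib)
  then show ?thesis using a(1) action_le
    by (intro bexI[of _ a]) (auto simp: killed_diff K_diff)
qed

lemma U_diff_bounded: "\<exists>C. \<forall>x. U g x - U h x \<le> C * V x"
proof -
  obtain C D where "\<And>x. \<bar>U g x\<bar> \<le> C * V x" "\<And>x. \<bar>U h x\<bar> \<le> D * V x"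
    using U_bounded by meson
  then have "U g x - U h x \<le> (C + D) * V x" for x
    unfolding distrib_right by (smt (verit))
  then show ?thesis by blast
qed

lemma U_decreasing:
  assumes "g \<le> h"
  shows "U h x \<le> U g x - (h - g) / \<Lambda>"
proof -
  have le0: "(g - h) / \<Lambda> \<le> 0" using assms \<Lambda>_pos by (simp add: divide_nonpos_pos)
  obtain C where C: "\<And>x. U h x - U g x \<le> C * V x" using U_diff_bounded by blast
  have neg: "U h y - U g y \<le> 0" for y
  proof (rule killed_maximum_principle[where w = "\<lambda>y. U h y - U g y", OF C])
    fix y
    obtain a where "a \<in> {\<gamma>..R}" "U h y - U g y \<le> (g - h) / \<Lambda> + K a (killed (\<lambda>y. U h y - U g y)) y"
      using U_diff_step by blast
    then show "\<exists>a\<in>{\<gamma>..R}. U h y - U g y \<le> K a (killed (\<lambda>y. U h y - U g y)) y"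
      using le0 by (intro bexI[of _ a]) linarith+
  qed
  obtain a where a: "a \<in> {\<gamma>..R}" "U h x - U g x \<le> (g - h) / \<Lambda> + K a (killed (\<lambda>y. U h y - U g y)) x"
    using U_diff_step by blast
  have "K a (killed (\<lambda>y. U h y - U g y)) x \<le> K a (\<lambda>_. 0) x"
    by (rule K_mono[OF a(1)]) (use neg in \<open>auto simp: killed_def\<close>)
  also have "\<dots> = 0" by (simp add: K_def G_const)
  finally show ?thesis using a(2) by (simp add: diff_divide_distrib)
qed

lemma U_lipschitz:
  assumes "g \<le> h"
  shows "U g x \<le> U h x + (h - g) / (\<Lambda> * (1 - \<rho>)) * V x"
proof -
  define k where "k = (h - g) / (\<Lambda> * (1 - \<rho>))"
  have k0: "0 \<le> k" using assms \<Lambda>_pos \<rho>_bounds by (simp add: k_def)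
  have k: "k * (1 - \<rho>) = (h - g) / \<Lambda>" using \<rho>_bounds by (simp add: k_def)
  obtain C where C: "\<And>x. U g x - U h x \<le> C * V x" using U_diff_bounded by blast
  define w where "w y = U g y - U h y - k * V y" for y
  have "w x \<le> 0"
  proof (rule killed_maximum_principle[where C = C])
    fix y
    have "0 \<le> k * V y" using k0 V_ge_1[of y] by simp
    then show "w y \<le> C * V y" using C[of y] by (simp add: w_def)
    obtain a where a: "a \<in> {\<gamma>..R}" "U g y - U h y \<le> (h - g) / \<Lambda> + K a (killed (\<lambda>y. U g y - U h y)) y"
      using U_diff_step by blast
    have "K a (killed w) y = K a (killed (\<lambda>y. U g y - U h y)) y - k * K a (killed V) y"
      unfolding w_def by (simp only: killed_diff killed_scale K_diff K_scale)
    moreover have "k * K a (killed V) y \<le> k * (\<rho> * V y)" using k0 by (intro mult_left_mono K_killed_V a)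
    moreover have "k * (1 - \<rho>) * 1 \<le> k * (1 - \<rho>) * V y"
      using k0 \<rho>_bounds by (intro mult_left_mono V_ge_1) auto
    ultimately have "w y \<le> K a (killed w) y"
      using a(2) unfolding w_def k by (simp add: algebra_simps flip: k)
    then show "\<exists>a\<in>{\<gamma>..R}. w y \<le> K a (killed w) y" using a(1) by blast
  qed
  then show ?thesis by (simp add: w_def k_def)
qed

lemma U_0_nonneg: "0 \<le> U 0 x"
proof -
  obtain C where C: "\<And>x. \<bar>U 0 x\<bar> \<le> C * V x" using U_bounded by blast
  have "- U 0 x \<le> 0"
  proof (rule killed_maximum_principle[where C = C and w = "\<lambda>x. - U 0 x"])
    fix y
    show "- U 0 y \<le> C * V y" using C[of y] by linarith
    obtain a where a: "a \<in> {\<gamma>, R}" "U 0 y = (r y a - 0) / \<Lambda> + K a (killed (U 0)) y"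
      by (rule U_attained)
    then have a': "a \<in> {\<gamma>..R}" using action_le by auto
    have "0 \<le> r y a / \<Lambda>" using cost_nonneg[OF a'] \<Lambda>_pos by simp
    moreover have "K a (killed (\<lambda>y. - U 0 y)) y = - K a (killed (U 0)) y"
      using killed_scale[of "-1" "U 0"] K_scale[of a "-1" "killed (U 0)"] by simp
    ultimately show "\<exists>a\<in>{\<gamma>..R}. - U 0 y \<le> K a (killed (\<lambda>y. - U 0 y)) y"
      using a(2) a' by (intro bexI[of _ a]) auto
  qed
  then show ?thesis by simp
qed

text \<open>If the value at \<open>z\<close> itself is \<open>0\<close>, killing has no effect and the fixed point equation is the
  optimality equation. The value at \<open>z\<close> is continuous in \<open>g\<close>, nonnegative for \<open>g = 0\<close> and, decreasing
  at rate at least \<open>1 / \<Lambda>\<close>, nonpositive for \<open>g = \<Lambda> * U 0 z\<close>.\<close>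

lemma acoe_solvable: "\<exists>g u. acoe g u \<and> (\<exists>C. \<forall>x. \<bar>u x\<bar> \<le> C * W x)"
proof -
  define h where "h = \<Lambda> * U 0 z"
  have h0: "0 \<le> h" using U_0_nonneg \<Lambda>_pos by (simp add: h_def)
  have hz: "U h z \<le> 0" using U_decreasing[OF h0, of z] \<Lambda>_pos by (simp add: h_def)
  define k where "k = B / (\<Lambda> * (1 - \<rho>))"
  have k0: "0 \<le> k" using B_ge \<Lambda>_pos \<rho>_bounds by (simp add: k_def)
  have lip: "\<bar>U g z - U g' z\<bar> \<le> k * \<bar>g - g'\<bar>" for g g'
  proof (induction g g' rule: linorder_wlog)
    case (le g g')
    have "0 \<le> (g' - g) / \<Lambda>" using le \<Lambda>_pos by simp
    then show ?case using U_lipschitz[OF le, of z] U_decreasing[OF le, of z] le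
      by (simp add: k_def V_def mult.commute)
  qed (simp add: abs_minus_commute)
  have "k-lipschitz_on {0..h} (\<lambda>g. U g z)"
    by (rule lipschitz_onI) (use lip k0 in \<open>auto simp: dist_real_def\<close>)
  then have "continuous_on {0..h} (\<lambda>g. U g z)" by (rule lipschitz_on_continuous_on)
  then obtain g where g: "U g z = 0"
    using IVT2'[of "\<lambda>g. U g z" h 0 0] hz U_0_nonneg[of z] h0 by auto
  have killed_U: "killed (U g) = U g" using g by (auto simp: killed_def)
  have "acoe g (U g)"
    unfolding acoe_def
  proof
    fix x
    obtain a where a: "a \<in> {\<gamma>, R}" "U g x = (r x a - g) / \<Lambda> + K a (killed (U g)) x"
      by (rule U_attained)
    have "(r x a + G a (U g) x - g) / \<Lambda> = 0"
      using a(2) by (simp add: killed_U K_def add_divide_distrib diff_divide_distrib)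
    then have eq: "g = r x a + G a (U g) x" using \<Lambda>_pos by simp
    have le: "g \<le> r x a' + G a' (U g) x" if "a' \<in> {\<gamma>, R}" for a'
    proof -
      have "0 \<le> (r x a' + G a' (U g) x - g) / \<Lambda>"
        using U_le[OF that, of g x] by (simp add: killed_U K_def add_divide_distrib diff_divide_distrib)
      then show ?thesis using \<Lambda>_pos by (simp add: zero_le_divide_iff)
    qed
    show "g = min (r x \<gamma> + G \<gamma> (U g) x) (r x R + G R (U g) x)"
      using le[of \<gamma>] le[of R] eq a(1) by (auto simp: min_def)
  qed
  moreover obtain C where C: "\<And>x. \<bar>U g x\<bar> \<le> C * V x" using U_bounded by blast
  have "\<bar>U g x\<bar> \<le> \<bar>C\<bar> * B * W x" for x
  proof -
    have "C * V x \<le> \<bar>C\<bar> * V x" using V_ge_1[of x] by (intro mult_right_mono) auto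
    also have "\<dots> \<le> \<bar>C\<bar> * (B * W x)" by (intro mult_left_mono V_le_W) auto
    finally show ?thesis using C[of x] by simp
  qed
  ultimately show ?thesis by blast
qed

end

section \<open>The production-inventory rates\<close>

text \<open>The states that carry the row of \<open>(n, i)\<close>. The truncated subtraction at \<open>n = 0\<close> or \<open>i = 0\<close> only adds
  a state of rate \<open>0\<close>, or the state itself.\<close>

fun neighbours :: "state \<Rightarrow> state set" where
  "neighbours (n, i) = {(n, i), (n, Suc i), (Suc n, i), (n - 1, i - 1)}"

lemma finite_neighbours: "finite (neighbours x)"
  and self_in_neighbours: "x \<in> neighbours x"
  by (cases x; simp)+

lemma jump_rate_outside: "y \<notin> neighbours x \<Longrightarrow> jump_rate lam mu a x y = 0"
  by (cases x; cases y) auto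

lemma rate_outside: "y \<notin> neighbours x \<Longrightarrow> rate lam mu a x y = 0"
  using self_in_neighbours[of x] by (cases "y = x") (simp_all add: rate_def jump_rate_outside)

lemma rate_diagonal: "rate lam mu a x x = - (\<Sum>y\<in>neighbours x - {x}. jump_rate lam mu a x y)"
proof -
  have "(\<Sum>\<^sub>\<infinity>y\<in>UNIV - {x}. jump_rate lam mu a x y) = (\<Sum>\<^sub>\<infinity>y\<in>neighbours x - {x}. jump_rate lam mu a x y)"
    by (rule infsum_cong_neutral) (auto simp: jump_rate_outside)
  then show ?thesis using finite_neighbours by (simp add: rate_def)
qed

lemma rate_conservative: "(\<Sum>y\<in>neighbours x. rate lam mu a x y) = 0"
proof -
  have "(\<Sum>y\<in>neighbours x. rate lam mu a x y) =
      rate lam mu a x x + (\<Sum>y\<in>neighbours x - {x}. rate lam mu a x y)"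
    by (rule sum.remove[OF finite_neighbours self_in_neighbours])
  also have "(\<Sum>y\<in>neighbours x - {x}. rate lam mu a x y) = (\<Sum>y\<in>neighbours x - {x}. jump_rate lam mu a x y)"
    by (rule sum.cong) (auto simp: rate_def)
  finally show ?thesis by (simp add: rate_diagonal)
qed

lemma jump_rate_nonneg: "0 \<le> lam \<Longrightarrow> 0 \<le> mu \<Longrightarrow> 0 \<le> a \<Longrightarrow> 0 \<le> jump_rate lam mu a x y"
  by (cases x; cases y) auto

lemma exit_rate_bound:
  assumes "0 \<le> lam" "0 \<le> mu" "0 \<le> a"
  shows "- rate lam mu a x x \<le> a + lam + mu"
proof -
  obtain n i where x: "x = (n, i)" by (cases x)
  have "neighbours x - {x} \<subseteq> {(n, Suc i), (Suc n, i), (n - 1, i - 1)}" unfolding x by auto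
  then have "(\<Sum>y\<in>neighbours x - {x}. jump_rate lam mu a x y) \<le>
      (\<Sum>y\<in>{(n, Suc i), (Suc n, i), (n - 1, i - 1)}. jump_rate lam mu a x y)"
    by (intro sum_mono2) (use assms jump_rate_nonneg in auto)
  also have "\<dots> \<le> a + lam + mu" using assms unfolding x by (cases n; cases i) auto
  finally show ?thesis by (simp add: rate_diagonal)
qed

lemma rate_affine: "rate lam mu a x y = rate lam mu 0 x y + a * (rate lam mu 1 x y - rate lam mu 0 x y)"
proof -
  have jump: "jump_rate lam mu a x y = jump_rate lam mu 0 x y + a * (jump_rate lam mu 1 x y - jump_rate lam mu 0 x y)" for x y
    by (cases x; cases y) auto
  show ?thesis
  proof (cases "y = x")
    case True
    have "(\<Sum>y\<in>neighbours x - {x}. jump_rate lam mu a x y) =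
        (\<Sum>y\<in>neighbours x - {x}. jump_rate lam mu 0 x y) +
        a * ((\<Sum>y\<in>neighbours x - {x}. jump_rate lam mu 1 x y) - (\<Sum>y\<in>neighbours x - {x}. jump_rate lam mu 0 x y))"
      by (subst jump) (simp add: sum.distrib sum_subtractf flip: sum_distrib_left)
    then show ?thesis using True by (simp add: rate_diagonal algebra_simps)
  next
    case False
    then show ?thesis using jump by (simp add: rate_def)
  qed
qed

lemma cost_rate_affine:
  "cost_rate c0 c1 c2 c3 S x a = cost_rate c0 c1 c2 c3 S x 0 +
    a * (cost_rate c0 c1 c2 c3 S x 1 - cost_rate c0 c1 c2 c3 S x 0)"
  by (cases x) (simp add: algebra_simps)

lemma weighted_space_iff:
  assumes "\<And>x. 1 \<le> V x"
  shows "u \<in> weighted_space V \<longleftrightarrow> (\<exists>C. \<forall>x. \<bar>u x\<bar> \<le> C * V x)"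
proof -
  have "\<bar>u x\<bar> / V x \<le> C \<longleftrightarrow> \<bar>u x\<bar> \<le> C * V x" for x C
    using assms[of x] by (intro pos_divide_le_eq) linarith
  then show ?thesis by (auto simp: weighted_space_def bdd_above_def)
qed

section \<open>Average costs of the controlled chain\<close>

text \<open>The model of the theorem, with the constants of the drift condition fixed.\<close>

locale inventory_control =
  fixes lam mu \<gamma> R c0 c1 c2 c3 :: real and S :: nat
    and Pr :: "policy \<Rightarrow> state \<Rightarrow> 'w measure"
    and Y :: "policy \<Rightarrow> real \<Rightarrow> 'w \<Rightarrow> state"
    and W :: "state \<Rightarrow> real" and c b M :: real
  assumes lam_pos: "lam > 0" and mu_pos: "mu > 0" and \<gamma>_pos: "0 < \<gamma>" and \<gamma>_le_R: "\<gamma> \<le> R"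
    and c_nonneg: "c0 \<ge> 0" "c1 \<ge> 0" "c2 \<ge> 0" "c3 \<ge> 0"
    and chain: "\<beta> \<in> stationary_policies {\<gamma>..R} \<Longrightarrow>
      markov_chain (Pr \<beta> x) (Y \<beta>) (policy_rate (rate lam mu) \<beta>) x"
    and W_ge_1: "1 \<le> W x"
    and c_pos: "0 < c" and b_nonneg: "0 \<le> b"
    and drift: "a \<in> {\<gamma>..R} \<Longrightarrow>
      (\<Sum>\<^sub>\<infinity>y. rate lam mu a x y * W y) \<le> - c * W x + b * of_bool (x = (0, 0))"
    and cost_le: "a \<in> {\<gamma>..R} \<Longrightarrow> cost_rate c0 c1 c2 c3 S x a \<le> M * W x"
    and ergodic: "assumption_III {\<gamma>..R} Pr Y W"
begin

abbreviation "q \<equiv> rate lam mu"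
abbreviation "r \<equiv> cost_rate c0 c1 c2 c3 S"
abbreviation "policies \<equiv> stationary_policies {\<gamma>..R}"

lemma policy_action: "\<beta> \<in> policies \<Longrightarrow> \<beta> x \<in> {\<gamma>..R}"
  unfolding stationary_policies_def by blast

lemma cost_rate_nonneg: "a \<ge> 0 \<Longrightarrow> 0 \<le> r x a"
  using c_nonneg by (cases x) auto

lemma infsum_rate: "(\<Sum>\<^sub>\<infinity>y. q a x y * u y) = (\<Sum>y\<in>neighbours x. q a x y * u y)"
proof -
  have "(\<Sum>\<^sub>\<infinity>y. q a x y * u y) = (\<Sum>\<^sub>\<infinity>y\<in>neighbours x. q a x y * u y)"
    by (rule infsum_cong_neutral) (auto simp: rate_outside)
  then show ?thesis using finite_neighbours by simp
qed

lemma objective_affine: "\<exists>\<alpha> \<kappa>. \<forall>a. r x a + (\<Sum>y\<in>neighbours x. q a x y * u y) = \<alpha> + a * \<kappa>"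
proof -
  have sum: "(\<Sum>y\<in>neighbours x. q a x y * u y) = (\<Sum>y\<in>neighbours x. q 0 x y * u y) +
      a * (\<Sum>y\<in>neighbours x. (q 1 x y - q 0 x y) * u y)" for a
    by (subst rate_affine) (simp add: sum_distrib_left sum.distrib[symmetric] algebra_simps)
  have "r x a + (\<Sum>y\<in>neighbours x. q a x y * u y) =
      (r x 0 + (\<Sum>y\<in>neighbours x. q 0 x y * u y)) +
      a * ((r x 1 - r x 0) + (\<Sum>y\<in>neighbours x. (q 1 x y - q 0 x y) * u y))" for a
    by (subst cost_rate_affine, subst sum) (simp only: distrib_left add_ac)
  then show ?thesis by blast
qed

sublocale affine_control q r \<gamma> R neighbours "R + lam + mu" W "(0, 0)" c b M
proof
  show "0 \<le> q a x y" if "a \<in> {\<gamma>..R}" "x \<noteq> y" for a x y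
    using that lam_pos mu_pos \<gamma>_pos jump_rate_nonneg[of lam mu a x y] by (simp add: rate_def)
  show "- q a x x \<le> R + lam + mu" if "a \<in> {\<gamma>..R}" for a x
    using exit_rate_bound[of lam mu a x] that lam_pos mu_pos \<gamma>_pos by auto
  show "(\<Sum>y\<in>neighbours x. q a x y * W y) \<le> - c * W x + b * of_bool (x = (0, 0))" if "a \<in> {\<gamma>..R}" for a x
    using drift[OF that, of x] by (simp only: infsum_rate)
  show "0 \<le> r x a" if "a \<in> {\<gamma>..R}" for a x
    using that \<gamma>_pos by (intro cost_rate_nonneg) auto
qed (use \<gamma>_le_R lam_pos mu_pos \<gamma>_pos W_ge_1 c_pos b_nonneg cost_le in
    \<open>auto simp: finite_neighbours self_in_neighbours rate_outside rate_conservative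
      simp del: cost_rate.simps intro: objective_affine\<close>)

lemma acoe_iff: "solves_ACOE {\<gamma>..R} q r g u \<longleftrightarrow> acoe g u"
  by (simp add: solves_ACOE_def acoe_def infsum_G INF_objective)

lemma attains_iff: "attains_ACOE q r g u \<beta> \<longleftrightarrow> (\<forall>x. g = r x (\<beta> x) + G (\<beta> x) u x)"
  by (simp add: attains_ACOE_def policy_rate_def infsum_G)

lemma reachable_from_origin:
  assumes \<beta>: "\<beta> \<in> policies"
  shows "(\<lambda>w y. w \<noteq> y \<and> 0 < policy_rate q \<beta> w y)\<^sup>*\<^sup>* (0, 0) (n, i)"
    (is "?R\<^sup>*\<^sup>* _ _")
proof -
  have \<beta>_pos: "0 < \<beta> x" for x
    using policy_action[OF \<beta>, of x] \<gamma>_pos by simp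
  have produce: "?R (n, i) (n, Suc i)" for n i
    using \<beta>_pos by (simp add: policy_rate_def rate_def)
  have arrive: "?R (n, Suc i) (Suc n, Suc i)" for n i
    using lam_pos by (simp add: policy_rate_def rate_def)
  have serve: "?R (Suc n, Suc i) (n, i)" for n i
    using mu_pos by (simp add: policy_rate_def rate_def)
  have base: "?R\<^sup>*\<^sup>* (0, 0) (n, 1)" for n
  proof (induction n)
    case 0
    show ?case using produce[of 0 0] by (simp add: r_into_rtranclp)
  next
    case (Suc n)
    then show ?case using arrive[of n 0] by (simp add: rtranclp.rtrancl_into_rtrancl)
  qed
  have pos: "?R\<^sup>*\<^sup>* (0, 0) (n, Suc i)" for n i
  proof (induction i)
    case 0
    show ?case using base[of n] by simp
  next
    case (Suc i)
    then show ?case using produce by (rule rtranclp.rtrancl_into_rtrancl)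
  qed
  show ?thesis
  proof (cases i)
    case 0
    then show ?thesis using rtranclp.rtrancl_into_rtrancl[OF pos serve, of n 0] by simp
  next
    case (Suc j)
    then show ?thesis using pos by simp
  qed
qed

lemma policy_semigroup:
  assumes \<beta>: "\<beta> \<in> policies" and P: "transition_function P" "has_rates P (policy_rate q \<beta>)"
  shows "Lyapunov_semigroup P (policy_rate q \<beta>) neighbours (R + lam + mu) W (0, 0) c b"
proof -
  note \<beta>_in = policy_action[OF \<beta>]
  interpret bounded_rate_semigroup P "policy_rate q \<beta>" neighbours "R + lam + mu"
  proof
    show "- policy_rate q \<beta> x x \<le> R + lam + mu" for x
      unfolding policy_rate_def by (rule exit_rate_le[OF \<beta>_in])
  qed (simp_all add: P policy_rate_def finite_neighbours self_in_neighbours rate_outside rate_conservative)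
  show ?thesis
  proof
    show "0 \<le> policy_rate q \<beta> x y" if "x \<noteq> y" for x y
      unfolding policy_rate_def by (rule q_nonneg[OF \<beta>_in that])
    show "L W x \<le> - c * W x + b * of_bool (x = (0, 0))" for x
      using drift[OF \<beta>_in, of x x] by (simp only: L_def policy_rate_def infsum_rate)
  qed (use W_ge_1 c_pos b_nonneg in auto)
qed

text \<open>The expected cost up to time \<open>T\<close>.\<close>

definition cumulative_cost :: "policy \<Rightarrow> state \<Rightarrow> real \<Rightarrow> ennreal" where
  "cumulative_cost \<beta> x T = (\<integral>\<^sup>+\<omega>. (\<integral>\<^sup>+t\<in>{0..T}.
    ennreal (r (Y \<beta> t \<omega>) (\<beta> (Lim (at_left t) (\<lambda>s. Y \<beta> s \<omega>)))) \<partial>lborel) \<partial>Pr \<beta> x)"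

text \<open>Dynkin's formula for a solution \<open>(g, u)\<close> of the optimality equation: up to a bounded error \<open>e\<close>, the
  expected cost exceeds \<open>g * T\<close> by the integral \<open>I\<close> of the discrepancy \<open>r + G u - g \<ge> 0\<close> against the
  occupation measure. The integral grows at least linearly as soon as the discrepancy is positive somewhere.
  Uniform ergodicity bounds the error.\<close>

lemma cumulative_cost_decomposition:
  assumes \<beta>: "\<beta> \<in> policies" and u: "acoe g u" "\<And>x. \<bar>u x\<bar> \<le> C * W x"
  obtains I e D where
    "\<And>T. T \<ge> 0 \<Longrightarrow> cumulative_cost \<beta> x T = ennreal (g * T + I T + e T)"
    "\<And>T. T \<ge> 0 \<Longrightarrow> 0 \<le> g * T + I T + e T"
    "\<And>T. T \<ge> 0 \<Longrightarrow> \<bar>e T\<bar> \<le> D"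
    "\<And>T. T \<ge> 0 \<Longrightarrow> 0 \<le> I T"
    "\<And>T. (\<forall>y. g = r y (\<beta> y) + G (\<beta> y) u y) \<Longrightarrow> I T = 0"
    "\<And>y. g \<noteq> r y (\<beta> y) + G (\<beta> y) u y \<Longrightarrow> \<exists>\<epsilon>>0. \<exists>D'. \<forall>T\<ge>0. \<epsilon> * T - D' \<le> I T"
proof -
  let ?Q = "policy_rate q \<beta>"
  have \<beta>_in: "\<beta> y \<in> {\<gamma>..R}" for y using \<beta> by (rule policy_action)
  obtain P where P: "transition_function P" "has_rates P ?Q" "markov_with (Pr \<beta> x) (Y \<beta>) P"
    using chain[OF \<beta>, of x] by (auto simp: markov_chain_def)
  interpret semi: Lyapunov_semigroup P ?Q neighbours "R + lam + mu" W "(0, 0)" c b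
    by (rule policy_semigroup[OF \<beta> P(1,2)])
  have law: "distr (Pr \<beta> x) (count_space UNIV) (Y \<beta> t) = measure_pmf (P t x)" if "t \<ge> 0" for t
    by (rule markov_chain_law[OF chain[OF \<beta>] P(3,1) that])
  have L_eq: "semi.L v y = G (\<beta> y) v y" for v y
    by (simp add: semi.L_def G_def policy_rate_def)
  define d where "d y = r y (\<beta> y) + G (\<beta> y) u y - g" for y
  define I where "I T = (\<integral>y. d y \<partial>semi.occupation x T)" for T
  define e where "e T = u x - measure_pmf.expectation (P T x) u" for T
  have d_nonneg: "0 \<le> d y" for y using acoe_le[OF u(1) \<beta>_in] by (simp add: d_def)
  have r_abs: "\<bar>r y (\<beta> y)\<bar> \<le> M * W y" for y
    using cost_nonneg[OF \<beta>_in] cost_le[OF \<beta>_in] by (simp add: abs_of_nonneg)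
  have int_r: "integrable (semi.occupation x T) (\<lambda>y. r y (\<beta> y))" if "T \<ge> 0" for T
    by (rule semi.integrable_weighted(2)[OF that r_abs])
  have int_L: "integrable (semi.occupation x T) (\<lambda>y. G (\<beta> y) u y)" if "T \<ge> 0" for T
    using semi.integrable_weighted(2)[OF that semi.L_weighted_bound[OF u(2)]] unfolding L_eq .
  have int_1: "integrable (semi.occupation x T) (\<lambda>y. k)" if "T \<ge> 0" for T and k :: real
    by (rule semi.integrable_occupation_bounded[OF that, where C = "\<bar>k\<bar>"]) simp
  have int_d: "integrable (semi.occupation x T) d" if "T \<ge> 0" for T
    unfolding d_def by (intro Bochner_Integration.integrable_diff Bochner_Integration.integrable_add int_r int_L int_1 that)
  have mass: "measure (semi.occupation x T) UNIV = T" if "T \<ge> 0" for T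
    using that by (simp add: measure_def semi.emeasure_occupation_UNIV)
  have cost_integral: "(\<integral>y. r y (\<beta> y) \<partial>semi.occupation x T) = g * T + I T + e T" if T: "T \<ge> 0" for T
  proof -
    have "I T = (\<integral>y. r y (\<beta> y) \<partial>semi.occupation x T) + (\<integral>y. G (\<beta> y) u y \<partial>semi.occupation x T)
        - (\<integral>y. g \<partial>semi.occupation x T)"
      unfolding I_def d_def
      by (subst Bochner_Integration.integral_diff[OF Bochner_Integration.integrable_add[OF int_r[OF T] int_L[OF T]] int_1[OF T]],
          subst Bochner_Integration.integral_add[OF int_r[OF T] int_L[OF T]]) simp
    moreover have "(\<integral>y. G (\<beta> y) u y \<partial>semi.occupation x T) = - e T"
      using semi.Dynkin_weighted[OF T u(2), of x] by (simp add: e_def L_eq)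
    ultimately show ?thesis using mass[OF T] by (simp add: mult.commute)
  qed
  obtain \<delta> L where III: "\<delta> > 0" "L > 0" "\<And>x u t \<beta>. u \<in> weighted_space W \<Longrightarrow> t \<ge> 0 \<Longrightarrow> \<beta> \<in> policies \<Longrightarrow>
      \<bar>(\<integral>\<omega>. u (Y \<beta> t \<omega>) \<partial>Pr \<beta> x) - pmf_mean (the_invariant_pmf (Pr \<beta>) (Y \<beta>)) u\<bar>
        \<le> L * exp (- \<delta> * t) * weighted_norm W u * W x"
    using ergodic unfolding assumption_III_def by blast
  define \<kappa> where "\<kappa> = pmf_mean (the_invariant_pmf (Pr \<beta>) (Y \<beta>)) u"
  show ?thesis
  proof (rule that)
    fix T :: real assume T: "T \<ge> 0"
    have "cumulative_cost \<beta> x T = (\<integral>\<^sup>+y. ennreal (r y (\<beta> y)) \<partial>semi.occupation x T)"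
      unfolding cumulative_cost_def semi.nn_integral_occupation
      by (rule expected_cost_eq[where P = P and f = "\<lambda>y y'. ennreal (r y (\<beta> y'))", OF chain[OF \<beta>, of x] law])
    also have "\<dots> = ennreal (\<integral>y. r y (\<beta> y) \<partial>semi.occupation x T)"
      by (rule nn_integral_eq_integral) (use int_r[OF T] cost_nonneg[OF \<beta>_in] in auto)
    finally show "cumulative_cost \<beta> x T = ennreal (g * T + I T + e T)"
      by (simp only: cost_integral[OF T])
    show "0 \<le> g * T + I T + e T"
      unfolding cost_integral[OF T, symmetric]
      by (rule Bochner_Integration.integral_nonneg) (rule cost_nonneg[OF \<beta>_in])
    show "0 \<le> I T" unfolding I_def by (rule Bochner_Integration.integral_nonneg) (rule d_nonneg)
  next
    fix T :: real assume T: "T \<ge> 0"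
    have uW: "u \<in> weighted_space W" using u(2) by (subst weighted_space_iff[of W, OF W_ge_1]) blast
    have Ym: "Y \<beta> T \<in> measurable (Pr \<beta> x) (count_space UNIV)"
      using chain[OF \<beta>, of x] T by (simp add: markov_chain_def)
    have "measure_pmf.expectation (P T x) u = (\<integral>\<omega>. u (Y \<beta> T \<omega>) \<partial>Pr \<beta> x)"
      unfolding law[OF T, symmetric] by (rule integral_distr[OF Ym]) simp
    then have "\<bar>measure_pmf.expectation (P T x) u - \<kappa>\<bar> \<le> L * exp (- \<delta> * T) * weighted_norm W u * W x"
      using III(3)[OF uW T \<beta>, of x] by (simp add: \<kappa>_def)
    also have "\<dots> \<le> L * 1 * \<bar>weighted_norm W u\<bar> * W x"
    proof (intro mult_right_mono)
      have "L * exp (- \<delta> * T) * weighted_norm W u \<le> L * exp (- \<delta> * T) * \<bar>weighted_norm W u\<bar>"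
        using III(2) by (intro mult_left_mono) auto
      also have "\<dots> \<le> L * 1 * \<bar>weighted_norm W u\<bar>"
        using III(1,2) T by (intro mult_right_mono mult_left_mono) auto
      finally show "L * exp (- \<delta> * T) * weighted_norm W u \<le> L * 1 * \<bar>weighted_norm W u\<bar>" .
    qed (use W_ge_1[of x] in auto)
    finally show "\<bar>e T\<bar> \<le> \<bar>u x\<bar> + \<bar>\<kappa>\<bar> + L * \<bar>weighted_norm W u\<bar> * W x"
      unfolding e_def by simp
  next
    fix T assume *: "\<forall>y. g = r y (\<beta> y) + G (\<beta> y) u y"
    have "d y = 0" for y using *[rule_format, of y] unfolding d_def by linarith
    then show "I T = 0" by (simp add: I_def)
  next
    fix y assume "g \<noteq> r y (\<beta> y) + G (\<beta> y) u y"
    then have dy: "0 < d y" using d_nonneg[of y] by (simp add: d_def)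
    have "(\<lambda>w y. w \<noteq> y \<and> 0 < ?Q w y)\<^sup>*\<^sup>* (0, 0) y"
      using reachable_from_origin[OF \<beta>] by (cases y) simp
    then obtain \<epsilon> D where \<epsilon>: "\<epsilon> > 0" "\<And>T. T \<ge> 0 \<Longrightarrow> \<epsilon> * T - D \<le> measure (semi.occupation x T) {y}"
      using semi.occupation_grows[of y x] by metis
    have "d y * \<epsilon> * T - d y * D \<le> I T" if T: "T \<ge> 0" for T
    proof -
      have "d y * \<epsilon> * T - d y * D = d y * (\<epsilon> * T - D)" by (simp add: algebra_simps)
      also have "\<dots> \<le> d y * measure (semi.occupation x T) {y}"
        using \<epsilon>(2)[OF T] dy by (intro mult_left_mono) auto
      also have "\<dots> = (\<integral>v. of_bool (v = y) * d y \<partial>semi.occupation x T)"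
        by (simp add: semi.integral_indicator_occupation)
      also have "\<dots> \<le> I T"
        unfolding I_def
        by (intro integral_mono int_d[OF T] semi.integrable_occupation_bounded[OF T, where C = "d y"])
          (use d_nonneg dy in auto)
      finally show ?thesis .
    qed
    then show "\<exists>\<epsilon>>0. \<exists>D'. \<forall>T\<ge>0. \<epsilon> * T - D' \<le> I T"
      using dy \<epsilon>(1) by (intro exI[of _ "d y * \<epsilon>"] conjI exI[of _ "d y * D"]) auto
  qed
qed

lemma average_cost_eq:
  assumes "\<And>T. T \<ge> 0 \<Longrightarrow> cumulative_cost \<beta> x T = ennreal (X T)" "\<And>T. T \<ge> 0 \<Longrightarrow> 0 \<le> X T"
  shows "average_cost r Pr Y x \<beta> = Limsup at_top (\<lambda>T. ereal (X T / T))"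
  unfolding average_cost_def cumulative_cost_def[symmetric]
proof (rule Limsup_eq)
  show "\<forall>\<^sub>F T in at_top. ereal (1 / T) * enn2ereal (cumulative_cost \<beta> x T) = ereal (X T / T)"
    using eventually_ge_at_top[of 0] by eventually_elim (simp add: assms)
qed

lemma average_cost_ge:
  assumes X: "\<And>T. T \<ge> 0 \<Longrightarrow> cumulative_cost \<beta> x T = ennreal (X T)" "\<And>T. T \<ge> 0 \<Longrightarrow> 0 \<le> X T"
    and ge: "\<And>T. T \<ge> 0 \<Longrightarrow> k * T - D \<le> X T"
  shows "ereal k \<le> average_cost r Pr Y x \<beta>"
proof -
  have "((\<lambda>T::real. k - D / T) \<longlongrightarrow> k - 0) at_top"
    by (intro tendsto_intros real_tendsto_divide_at_top[OF tendsto_const] filterlim_ident)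
  then have "((\<lambda>T. ereal (k - D / T)) \<longlongrightarrow> ereal k) at_top" by simp
  then have "ereal k = Limsup at_top (\<lambda>T. ereal (k - D / T))"
    by (intro lim_imp_Limsup[symmetric]) auto
  also have "\<dots> \<le> Limsup at_top (\<lambda>T. ereal (X T / T))"
  proof (rule Limsup_mono)
    show "\<forall>\<^sub>F T in at_top. ereal (k - D / T) \<le> ereal (X T / T)"
      using eventually_gt_at_top[of 0]
    proof eventually_elim
      case (elim T)
      have "k - D / T = (k * T - D) / T" using elim by (simp add: field_simps)
      also have "\<dots> \<le> X T / T" using ge[of T] elim by (intro divide_right_mono) auto
      finally show ?case by simp
    qed
  qed
  finally show ?thesis by (simp only: average_cost_eq[OF X])
qed

lemma average_cost_eqI:
  assumes X: "\<And>T. T \<ge> 0 \<Longrightarrow> cumulative_cost \<beta> x T = ennreal (k * T + e T)"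
      "\<And>T. T \<ge> 0 \<Longrightarrow> 0 \<le> k * T + e T"
    and e: "\<And>T. T \<ge> 0 \<Longrightarrow> \<bar>e T\<bar> \<le> D"
  shows "average_cost r Pr Y x \<beta> = ereal k"
proof -
  have "((\<lambda>T. e T / T) \<longlongrightarrow> 0) at_top"
  proof (rule Lim_null_comparison)
    show "((\<lambda>T. D / T) \<longlongrightarrow> 0) at_top"
      by (intro real_tendsto_divide_at_top[OF tendsto_const] filterlim_ident)
    show "\<forall>\<^sub>F T in at_top. norm (e T / T) \<le> D / T"
      using eventually_gt_at_top[of 0]
      by eventually_elim (use e in \<open>auto simp: abs_divide intro!: divide_right_mono\<close>)
  qed
  then have "((\<lambda>T. k + e T / T) \<longlongrightarrow> k + 0) at_top" by (intro tendsto_intros)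
  moreover have "\<forall>\<^sub>F T in at_top. k + e T / T = (k * T + e T) / T"
    using eventually_gt_at_top[of 0] by eventually_elim (simp add: field_simps)
  ultimately have "((\<lambda>T. (k * T + e T) / T) \<longlongrightarrow> k) at_top"
    by (simp add: tendsto_cong)
  then have "((\<lambda>T. ereal ((k * T + e T) / T)) \<longlongrightarrow> ereal k) at_top" by simp
  then have "Limsup at_top (\<lambda>T. ereal ((k * T + e T) / T)) = ereal k"
    by (intro lim_imp_Limsup) auto
  then show ?thesis
    using average_cost_eq[of \<beta> x "\<lambda>T. k * T + e T", OF X] by simp
qed

lemma
  assumes u: "acoe g u" "\<And>x. \<bar>u x\<bar> \<le> C * W x"
  shows average_cost_ge_acoe: "\<beta> \<in> policies \<Longrightarrow> ereal g \<le> average_cost r Pr Y x \<beta>"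
    and average_cost_eq_acoe_iff: "\<beta> \<in> policies \<Longrightarrow>
      average_cost r Pr Y x \<beta> = ereal g \<longleftrightarrow> (\<forall>y. g = r y (\<beta> y) + G (\<beta> y) u y)"
proof -
  assume \<beta>: "\<beta> \<in> policies"
  obtain I e D where dec:
    "\<And>T. T \<ge> 0 \<Longrightarrow> cumulative_cost \<beta> x T = ennreal (g * T + I T + e T)"
    "\<And>T. T \<ge> 0 \<Longrightarrow> 0 \<le> g * T + I T + e T"
    "\<And>T. T \<ge> 0 \<Longrightarrow> \<bar>e T\<bar> \<le> D"
    "\<And>T. T \<ge> 0 \<Longrightarrow> 0 \<le> I T"
    "\<And>T. (\<forall>y. g = r y (\<beta> y) + G (\<beta> y) u y) \<Longrightarrow> I T = 0"
    "\<And>y. g \<noteq> r y (\<beta> y) + G (\<beta> y) u y \<Longrightarrow> \<exists>\<epsilon>>0. \<exists>D'. \<forall>T\<ge>0. \<epsilon> * T - D' \<le> I T"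
    by (rule cumulative_cost_decomposition[OF \<beta> u, where x = x]) (rule that)
  show "ereal g \<le> average_cost r Pr Y x \<beta>"
  proof (rule average_cost_ge[OF dec(1,2)])
    show "g * T - D \<le> g * T + I T + e T" if "T \<ge> 0" for T
      using dec(3,4)[OF that] by linarith
  qed
  show "average_cost r Pr Y x \<beta> = ereal g \<longleftrightarrow> (\<forall>y. g = r y (\<beta> y) + G (\<beta> y) u y)"
  proof
    assume eq: "average_cost r Pr Y x \<beta> = ereal g"
    show "\<forall>y. g = r y (\<beta> y) + G (\<beta> y) u y"
    proof (rule ccontr)
      assume "\<not> ?thesis"
      then obtain \<epsilon> D' where \<epsilon>: "\<epsilon> > 0" "\<And>T. T \<ge> 0 \<Longrightarrow> \<epsilon> * T - D' \<le> I T"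
        using dec(6) by meson
      have "ereal (g + \<epsilon>) \<le> average_cost r Pr Y x \<beta>"
      proof (rule average_cost_ge[OF dec(1,2)])
        show "(g + \<epsilon>) * T - (D + D') \<le> g * T + I T + e T" if "T \<ge> 0" for T
          using dec(3)[OF that] \<epsilon>(2)[OF that] unfolding distrib_right by linarith
      qed
      then show False using eq \<epsilon>(1) by simp
    qed
  next
    assume "\<forall>y. g = r y (\<beta> y) + G (\<beta> y) u y"
    then have "I T = 0" for T by (rule dec(5))
    then show "average_cost r Pr Y x \<beta> = ereal g"
      using dec(1,2,3) by (intro average_cost_eqI[where e = e and D = D]) auto
  qed
qed

lemma optimal_average_cost_eq:
  assumes u: "acoe g u" "\<And>x. \<bar>u x\<bar> \<le> C * W x"
  shows "optimal_average_cost {\<gamma>..R} r Pr Y x = ereal g"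
proof -
  have "\<exists>a\<in>{\<gamma>..R}. g = r y a + G a u y" for y using acoe_attained[OF u(1)] by metis
  then obtain \<beta> where \<beta>: "\<And>y. \<beta> y \<in> {\<gamma>..R}" "\<And>y. g = r y (\<beta> y) + G (\<beta> y) u y" by metis
  have pol: "\<beta> \<in> policies" using \<beta>(1) by (simp add: stationary_policies_def)
  have "average_cost r Pr Y x \<beta> = ereal g"
    using average_cost_eq_acoe_iff[OF u pol] \<beta>(2) by blast
  then have "(INF \<beta>\<in>policies. average_cost r Pr Y x \<beta>) \<le> ereal g"
    using INF_lower[OF pol, of "average_cost r Pr Y x"] by simp
  moreover have "ereal g \<le> (INF \<beta>\<in>policies. average_cost r Pr Y x \<beta>)"
    by (rule INF_greatest) (rule average_cost_ge_acoe[OF u])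
  ultimately show ?thesis by (simp add: optimal_average_cost_def)
qed

end

section \<open>Solutions of the optimality equation and optimal policies\<close>

theorem theorem5p1:
  fixes lam mu \<gamma> R c0 c1 c2 c3 :: real and S :: nat
    and Pr :: "policy \<Rightarrow> state \<Rightarrow> 'w measure"
    and Y :: "policy \<Rightarrow> real \<Rightarrow> 'w \<Rightarrow> state"
    and W :: "state \<Rightarrow> real"
  assumes "lam > 0" "mu > 0" "0 < \<gamma>" "\<gamma> \<le> R"
    and "c0 \<ge> 0" "c1 \<ge> 0" "c2 \<ge> 0" "c3 \<ge> 0"
    and chain: "\<And>\<beta> x. \<beta> \<in> stationary_policies {\<gamma>..R} \<Longrightarrow>
      markov_chain (Pr \<beta> x) (Y \<beta>) (policy_rate (rate lam mu) \<beta>) x"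
    and I: "assumption_I {\<gamma>..R} (rate lam mu) (cost_rate c0 c1 c2 c3 S) W"
    and II: "assumption_II {\<gamma>..R} (rate lam mu) W"
    and III: "assumption_III {\<gamma>..R} Pr Y W"
  shows "(\<exists>g. \<exists>u\<in>weighted_space W.
            solves_ACOE {\<gamma>..R} (rate lam mu) (cost_rate c0 c1 c2 c3 S) g u) \<and>
    (\<forall>g. \<forall>u\<in>weighted_space W.
      solves_ACOE {\<gamma>..R} (rate lam mu) (cost_rate c0 c1 c2 c3 S) g u \<longrightarrow>
        (\<forall>x. ereal g = optimal_average_cost {\<gamma>..R} (cost_rate c0 c1 c2 c3 S) Pr Y x) \<and>
        (\<forall>g'. \<forall>u'\<in>weighted_space W.
          solves_ACOE {\<gamma>..R} (rate lam mu) (cost_rate c0 c1 c2 c3 S) g' u' \<longrightarrow>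
            (\<exists>k. \<forall>x. u' x = u x + k)) \<and>
        (\<forall>\<beta>\<in>stationary_policies {\<gamma>..R}.
          average_cost_optimal {\<gamma>..R} (cost_rate c0 c1 c2 c3 S) Pr Y \<beta> \<longleftrightarrow>
            attains_ACOE (rate lam mu) (cost_rate c0 c1 c2 c3 S) g u \<beta>))"
proof -
  obtain c b M where cb: "c > 0" "b \<ge> 0"
    and *: "\<forall>x. \<forall>a\<in>{\<gamma>..R}.
      (\<Sum>\<^sub>\<infinity>y. rate lam mu a x y * W y) \<le> - c * W x + b * of_bool (x = (0, 0)) \<and>
      cost_rate c0 c1 c2 c3 S x a \<le> M * W x"
    using I unfolding assumption_I_def by blast
  have W: "1 \<le> W x" for x using I unfolding assumption_I_def by blast
  have drift: "(\<Sum>\<^sub>\<infinity>y. rate lam mu a x y * W y) \<le> - c * W x + b * of_bool (x = (0, 0))"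
    and cost: "cost_rate c0 c1 c2 c3 S x a \<le> M * W x" if "a \<in> {\<gamma>..R}" for a x
    using * that by blast+
  interpret inventory_control lam mu \<gamma> R c0 c1 c2 c3 S Pr Y W c b M
    by (rule inventory_control.intro) (fact assms cb W drift cost)+
  note space_iff = weighted_space_iff[of W, OF W_ge_1]
  show ?thesis
  proof (intro conjI allI ballI impI)
    show "\<exists>g. \<exists>u\<in>weighted_space W. solves_ACOE {\<gamma>..R} q r g u"
    proof -
      obtain g u C where "acoe g u" "\<And>x. \<bar>u x\<bar> \<le> C * W x" using acoe_solvable by blast
      then show ?thesis unfolding acoe_iff using space_iff by blast
    qed
  next
    fix g u assume "u \<in> weighted_space W" and "solves_ACOE {\<gamma>..R} q r g u"
    then obtain C where u: "acoe g u" "\<And>x. \<bar>u x\<bar> \<le> C * W x"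
      unfolding acoe_iff space_iff by blast
    note J = optimal_average_cost_eq[OF u]
    show "ereal g = optimal_average_cost {\<gamma>..R} r Pr Y x" for x by (simp only: J)
    show "\<exists>k. \<forall>x. u' x = u x + k"
      if sol: "u' \<in> weighted_space W" "solves_ACOE {\<gamma>..R} q r g' u'" for g' u'
    proof -
      obtain C' where u': "acoe g' u'" "\<And>x. \<bar>u' x\<bar> \<le> C' * W x"
        using sol unfolding acoe_iff space_iff by blast
      have "ereal g' = ereal g"
        using J[of "(0, 0)"] optimal_average_cost_eq[OF u', of "(0, 0)"] by (rule trans[OF sym, rotated])
      then have "acoe g u'" using u'(1) by simp
      from acoe_unique[OF u this u'(2)] show ?thesis by blast
    qed
    show "average_cost_optimal {\<gamma>..R} r Pr Y \<beta> \<longleftrightarrow> attains_ACOE q r g u \<beta>"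
      if "\<beta> \<in> policies" for \<beta>
      unfolding average_cost_optimal_def attains_iff J
      using average_cost_eq_acoe_iff[OF u that] by blast
  qed
qed

end
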